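(* Let $n\ge 1$ and $0\le r\le n-1$ be integers, write $X=[n]=\{1,\dots,n\}$, $f_r=\sum_{j=0}^{r}\binom{n}{j}$ and $g_r=f_r+\binom{n-1}{r}$. Let $A\subseteq Q_n$ satisfy $f_r<|A|\le g_r$ (equivalently, $|X^{(\le r)}|<|A|\le |X^{(\le r)}\cup\{B\in X^{(r+1)}:1\in B\}|$). Put $s=n-r-1$ and $k=|A|-f_r$ (so $1\le k\le\binom{n-1}{s}$), let $\mathcal{A}\subseteq[n]^{(s)}$ be the initial segment of the colexicographic order on $[n]^{(s)}$ of size $k$, and for each $1\le i\le n$ define $\mathcal{A}_{i,0}=\{B\in X_i^{(s-1)}: B\cup\{i\}\in\mathcal{A}\}$, $\mathcal{A}_{i,1}=\{B\in X_i^{(s)}: B\in\mathcal{A}\}$, and $A_i=X^{(\ge s+1)}\cup\mathcal{A}_{i,1}\cup\mathcal{A}_{i,0}$ (so that $|A_i|=|A|$). Then $A$ is extremal if and only if $A$ is isomorphic to $A_i$ for some $i\in\{1,\dots,n\}$.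
   Context: $Q_n$ is the hypercube with vertex set the power set of $[n]$ and metric $d(x,y)=|x\Delta y|$. For $A\subseteq Q_n$ and $t>0$, $N^t(A)=\{x\in Q_n: \min_{y\in A}d(x,y)\le t\}$. We say $N^t(A)$ is minimal if $|N^t(A)|\le|N^t(B)|$ for every $B\subseteq Q_n$ with $|B|=|A|$. A set $A\subseteq Q_n$ is extremal if $N^t(A)$ and $N^t(A^c)$ are minimal for all integers $t>0$, where $A^c=Q_n\setminus A$. Two subsets of $Q_n$ are isomorphic if one is mapped to the other by an automorphism of $Q_n$ (i.e. a map $x\mapsto \sigma(x)\Delta I$ for a permutation $\sigma$ of $[n]$ and a fixed $I\subseteq[n]$). Notation: $X^{(j)}=\{B\subseteq X:|B|=j\}$, $X^{(\le j)}$, $X^{(\ge j)}$ similarly; $X_i=[n]\setminus\{i\}$ and $X_i^{(j)}$ its $j$-subsets. The colexicographic order on $[n]^{(s)}$: $A<_{colex}B$ iff $\max(A\Delta B)\in B$. *)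

theory Defs
  imports Main
begin

definition cube :: "nat \<Rightarrow> nat set set" where
  "cube n = Pow {1..n}"

definition hdist :: "nat set \<Rightarrow> nat set \<Rightarrow> nat" where
  "hdist x y = card ((x - y) \<union> (y - x))"

definition nbhd :: "nat \<Rightarrow> nat \<Rightarrow> nat set set \<Rightarrow> nat set set" where
  "nbhd n t A = {x \<in> cube n. \<exists>y\<in>A. hdist x y \<le> t}"

definition nbhd_minimal :: "nat \<Rightarrow> nat \<Rightarrow> nat set set \<Rightarrow> bool" where
  "nbhd_minimal n t A \<longleftrightarrow>
     (\<forall>B. B \<subseteq> cube n \<and> card B = card A \<longrightarrow> card (nbhd n t A) \<le> card (nbhd n t B))"

definition extremal :: "nat \<Rightarrow> nat set set \<Rightarrow> bool" where
  "extremal n A \<longleftrightarrow>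
     (\<forall>t::nat. t > 0 \<longrightarrow> nbhd_minimal n t A \<and> nbhd_minimal n t (cube n - A))"

definition cube_iso :: "nat \<Rightarrow> nat set set \<Rightarrow> nat set set \<Rightarrow> bool" where
  "cube_iso n A B \<longleftrightarrow>
     (\<exists>\<sigma> I. bij_betw \<sigma> {1..n} {1..n} \<and> I \<subseteq> {1..n} \<and>
        (\<lambda>x. ((\<sigma> ` x) - I) \<union> (I - (\<sigma> ` x))) ` A = B)"

definition colex_less :: "nat set \<Rightarrow> nat set \<Rightarrow> bool" where
  "colex_less A B \<longleftrightarrow> A \<noteq> B \<and> Max ((A - B) \<union> (B - A)) \<in> B"

definition layer :: "nat set \<Rightarrow> nat \<Rightarrow> nat set set" where
  "layer X j = {B. B \<subseteq> X \<and> card B = j}"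

definition colex_seg :: "nat \<Rightarrow> nat \<Rightarrow> nat \<Rightarrow> nat set set" where
  "colex_seg n s k =
     {B \<in> layer {1..n} s. card {C \<in> layer {1..n} s. colex_less C B} < k}"

definition f_r :: "nat \<Rightarrow> nat \<Rightarrow> nat" where
  "f_r n r = (\<Sum>j\<le>r. n choose j)"

definition g_r :: "nat \<Rightarrow> nat \<Rightarrow> nat" where
  "g_r n r = f_r n r + ((n - 1) choose r)"

text \<open>A_i = X^(\<ge> s+1) \<union> \<A>_{i,1} \<union> \<A>_{i,0} for a family \<A> of s-sets.
  (B \<in> X_i^(s-1) is written card B + 1 = s, so it is empty when s = 0.)\<close>
definition A_i :: "nat \<Rightarrow> nat \<Rightarrow> nat set set \<Rightarrow> nat \<Rightarrow> nat set set" where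
  "A_i n s \<A> i =
     {B. B \<subseteq> {1..n} \<and> card B \<ge> s + 1}
     \<union> {B. B \<subseteq> {1..n} - {i} \<and> card B = s \<and> B \<in> \<A>}
     \<union> {B. B \<subseteq> {1..n} - {i} \<and> card B + 1 = s \<and> insert i B \<in> \<A>}"

end

theory Submission
  imports Defs "HOL-Library.Nat_Bijection"
begin

text \<open>
  Order the cube by decreasing size and, within a size, colexicographically. Harper's theorem
  (proved by compressions) says that initial segments of this order have minimal neighbourhoods.
  The neighbourhoods of \<open>A_i\<close> are again of the form \<open>A_i\<close>, built from the iterated shadows of the
  family, so their sizes do not depend on \<open>i\<close>; for \<open>i\<close> outside the ground set one gets an initial
  segment, and the complement of \<open>A_i\<close> is isomorphic to a set of the same form. Hence all \<open>A_i\<close> are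
  extremal.

  Conversely, comparing an extremal \<open>A\<close> with the initial segment for the largest nontrivial radii
  yields a ball contained in \<open>A\<close> and a point far from \<open>A\<close>. The two centres are almost antipodal, which
  forces \<open>A\<close> to be \<open>A_i\<close> for some family \<open>F\<close> of \<open>s\<close>-sets. The iterated shadows of \<open>F\<close> and of
  its dual are then at most those of the colex segment. The shadow on level one shows
  that some point lies in no member of \<open>F\<close> (or of its dual), and deleting that point
  gives an induction showing that \<open>F\<close> is a permuted colex segment.
\<close>

section \<open>Initial segments of a finite set ordered by a key\<close>

text \<open>The bound \<open>card A \<le> g_r n r\<close> says
  \<open>k \<le> (n - 1 choose s)\<close>, so the colex segment avoids the point \<open>n\<close>.
  Deleting \<open>n\<close> then changes no member of it, and \<open>A_i\<close> with
  \<open>i = n\<close> is itself the initial segment of the cube. This is why a ball-like solution,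
  in which no coordinate is special, still appears in the list. The largest nontrivial radii are
  \<open>s - 1\<close> for \<open>A\<close> and \<open>n - s - 1\<close> for its complement: the
  initial segment has only sets of size at least \<open>s\<close>, so it stays at distance
  \<open>s\<close> from the empty set, and the sets outside it have size at most \<open>s\<close>,
  so they stay at distance \<open>n - s\<close> from the full set. Once the ball found in
  \<open>A\<close> is centred at the full set, a far point with two elements would be too close to
  that ball. The final induction carries the shadow inequalities of the family and of its dual
  together, because the colex segment need not avoid the last point, but then its dual does.
  Deleting an uncovered point leaves the shadows of the family alone and removes one full layer from
  those of the dual, the same number of sets on both sides.\<close>

definition initial :: "('a \<Rightarrow> int) \<Rightarrow> 'a set \<Rightarrow> 'a set \<Rightarrow> bool" where
  "initial f L I \<longleftrightarrow> I \<subseteq> L \<and> (\<forall>y\<in>I. \<forall>x\<in>L. f x < f y \<longrightarrow> x \<in> I)"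

lemma initial_subset: "initial f L I \<Longrightarrow> I \<subseteq> L"
  by (simp add: initial_def)

lemma initialD: "initial f L I \<Longrightarrow> y \<in> I \<Longrightarrow> x \<in> L \<Longrightarrow> f x < f y \<Longrightarrow> x \<in> I"
  by (simp add: initial_def)

lemma initial_exists:
  assumes "finite L" "inj_on f L" "m \<le> card L"
  shows "\<exists>I. initial f L I \<and> card I = m"
  using assms(3)
proof (induction m)
  case 0
  have "initial f L {}" by (simp add: initial_def)
  then show ?case by (metis card.empty)
next
  case (Suc m)
  then obtain I where I: "initial f L I" "card I = m" by auto
  have fI: "finite I" using I assms(1) initial_subset finite_subset by metis
  have ne: "L - I \<noteq> {}" using Suc.prems I(2) fI card_mono[OF fI, of L] by auto
  obtain x where x: "x \<in> L - I" "\<forall>y\<in>L - I. f x \<le> f y"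
    using ne assms(1) ex_is_arg_min_if_finite[of "L - I" f]
    by (auto simp: is_arg_min_def not_less)
  have "initial f L (insert x I)"
    unfolding initial_def
  proof (intro conjI ballI impI)
    show "insert x I \<subseteq> L" using x initial_subset[OF I(1)] by blast
    fix y w assume "y \<in> insert x I" "w \<in> L" "f w < f y"
    then show "w \<in> insert x I" using x(2) initialD[OF I(1), of y w] by force
  qed
  moreover have "card (insert x I) = Suc m" using x fI I(2) by simp
  ultimately show ?case by blast
qed

lemma initial_nested:
  assumes "initial f L I" "initial f L J" "inj_on f L"
  shows "I \<subseteq> J \<or> J \<subseteq> I"
proof (rule ccontr)
  assume "\<not> ?thesis"
  then obtain x y where xy: "x \<in> I" "x \<notin> J" "y \<in> J" "y \<notin> I" by blast
  then have "x \<in> L" "y \<in> L" using assms initial_subset by blast+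
  then have "f x \<noteq> f y" using assms(3) xy by (auto dest: inj_onD)
  then show False
    using initialD[OF assms(1)] initialD[OF assms(2)] xy \<open>x \<in> L\<close> \<open>y \<in> L\<close>
    by (meson linorder_neqE)
qed

lemma initial_card_subset:
  assumes "initial f L I" "initial f L J" "inj_on f L" "finite L" "card I \<le> card J"
  shows "I \<subseteq> J"
proof -
  have "finite I" using assms(1,4) initial_subset finite_subset by metis
  then show ?thesis
    using initial_nested[OF assms(1-3)] assms(5) card_seteq by blast
qed

text \<open>Pair off \<open>I - A\<close> with \<open>A - I\<close>: a member of \<open>I\<close>
  cannot have a larger key than its partner, or the partner would be forced into \<open>I\<close>.
  The strictness makes the key sum a potential for compressions.\<close>

lemma initial_sum_less:
  assumes I: "initial f L I" and "inj_on f L" "finite L" "A \<subseteq> L" "card A = card I" "A \<noteq> I"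
  shows "sum f I < sum f A"
proof -
  have fin: "finite A" "finite I" using assms finite_subset initial_subset by metis+
  have cd: "card (I - A) = card (A - I)"
    using fin assms(5) card_Diff_subset_Int[of I A] card_Diff_subset_Int[of A I]
    by (simp add: Int_commute)
  have ne: "I - A \<noteq> {}"
  proof
    assume "I - A = {}"
    then have "I \<subseteq> A" by blast
    then show False using card_subset_eq[OF fin(1)] assms(5,6) by metis
  qed
  obtain h where h: "bij_betw h (I - A) (A - I)"
    using cd fin by (metis finite_Diff finite_same_card_bij)
  have lt: "f x < f (h x)" if "x \<in> I - A" for x
  proof -
    have hx: "h x \<in> A - I" using h that bij_betwE by blast
    moreover have "x \<in> L" "h x \<in> L" using hx that assms(4) initial_subset[OF I] by auto
    moreover have "f x \<noteq> f (h x)"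
      using assms(2) hx that calculation by (auto dest: inj_onD)
    ultimately show ?thesis using initialD[OF I, of x "h x"] that by force
  qed
  have "sum f (I - A) < sum (\<lambda>x. f (h x)) (I - A)"
    using lt ne fin by (intro sum_strict_mono) auto
  also have "\<dots> = sum f (A - I)" using sum.reindex_bij_betw[OF h] by simp
  finally have "sum f (I - A) < sum f (A - I)" .
  moreover have "sum f I = sum f (I - A) + sum f (I \<inter> A)"
    using fin by (metis add.commute sum.Int_Diff)
  moreover have "sum f A = sum f (A - I) + sum f (I \<inter> A)"
    using fin by (metis add.commute inf.commute sum.Int_Diff)
  ultimately show ?thesis by linarith
qed

section \<open>Binary encoding and the simplicial key\<close>

lemma set_encode_less_power:
  assumes "A \<subseteq> {..<m}" shows "set_encode A < 2 ^ m"
proof -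
  have "set_encode A \<le> sum ((^) 2) {..<m}"
    unfolding set_encode_def using assms by (intro sum_mono2) auto
  also have "\<dots> < 2 ^ m" by (induction m) auto
  finally show ?thesis .
qed

lemma set_encode_Un:
  "finite A \<Longrightarrow> finite B \<Longrightarrow> A \<inter> B = {} \<Longrightarrow> set_encode (A \<union> B) = set_encode A + set_encode B"
  by (simp add: set_encode_def sum.union_disjoint)

text \<open>The power of two at the top difference outweighs all smaller ones together.\<close>

lemma set_encode_lessI:
  assumes "finite A" "finite B" "m \<in> B" "m \<notin> A" "\<And>i. i > m \<Longrightarrow> i \<in> A \<longleftrightarrow> i \<in> B"
  shows "set_encode A < set_encode B"
proof -
  have "set_encode A = set_encode (A \<inter> {m<..}) + set_encode (A \<inter> {..<m})"
    using assms by (subst set_encode_Un[symmetric]) (auto intro!: arg_cong[where f = set_encode] simp: not_less le_less)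
  also have "set_encode (A \<inter> {..<m}) < 2 ^ m" by (rule set_encode_less_power) auto
  also have "A \<inter> {m<..} = B \<inter> {m<..}" using assms(5) by auto
  also have "set_encode (B \<inter> {m<..}) + 2 ^ m = set_encode (insert m (B \<inter> {m<..}))"
    using assms(2) by simp
  also have "\<dots> \<le> set_encode B"
    unfolding set_encode_def using assms(2,3) by (intro sum_mono2) auto
  finally show ?thesis by simp
qed

lemma set_encode_lessE:
  assumes "finite A" "finite B" "set_encode A < set_encode B"
  obtains m where "m \<in> B" "m \<notin> A" "\<And>i. i > m \<Longrightarrow> i \<in> A \<longleftrightarrow> i \<in> B"
proof -
  let ?D = "(A - B) \<union> (B - A)"
  define m where "m = Max ?D"
  have D: "finite ?D" "?D \<noteq> {}" using assms by auto
  have m: "m \<in> ?D" unfolding m_def using Max_in[OF D] .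
  have gt: "i \<in> A \<longleftrightarrow> i \<in> B" if "i > m" for i
    using that Max_ge[OF D(1), of i] unfolding m_def by (meson DiffI UnCI not_le)
  have "m \<notin> A"
  proof
    assume "m \<in> A"
    then have "m \<notin> B" using m by blast
    then have "set_encode B < set_encode A"
      using set_encode_lessI[of B A m] assms \<open>m \<in> A\<close> gt by auto
    then show False using assms(3) by simp
  qed
  then show thesis using that m gt by blast
qed

lemma colex_less_iff:
  assumes "finite A" "finite B"
  shows "colex_less A B \<longleftrightarrow> set_encode A < set_encode B"
proof
  let ?D = "(A - B) \<union> (B - A)"
  assume "colex_less A B"
  then have D: "A \<noteq> B" "Max ?D \<in> B" by (auto simp: colex_less_def)
  have fD: "finite ?D" "?D \<noteq> {}" using assms D by auto
  have m: "Max ?D \<in> ?D" using Max_in[OF fD] .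
  have gt: "i \<in> A \<longleftrightarrow> i \<in> B" if "i > Max ?D" for i
    using that Max_ge[OF fD(1), of i] by (meson DiffI UnCI not_le)
  show "set_encode A < set_encode B"
    using set_encode_lessI[of A B "Max ?D"] assms D(2) m gt by blast
next
  assume "set_encode A < set_encode B"
  then obtain m where m: "m \<in> B" "m \<notin> A" "\<And>i. i > m \<Longrightarrow> i \<in> A \<longleftrightarrow> i \<in> B"
    using set_encode_lessE assms by metis
  have "Max ((A - B) \<union> (B - A)) = m"
    using assms m by (intro Max_eqI) (auto, (meson linorder_not_le)+)
  then show "colex_less A B" using m by (auto simp: colex_less_def)
qed

text \<open>Ordering by this key lists larger sets first and compares sets of equal size
  colexicographically. Its additivity makes it compatible with deleting a coordinate.\<close>

definition skey :: "nat \<Rightarrow> nat set \<Rightarrow> int" where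
  "skey n x = (\<Sum>i\<in>x. 2 ^ i - 2 ^ Suc n)"

lemma skey_eq: "skey n x = int (set_encode x) - int (card x) * 2 ^ Suc n"
  by (simp add: skey_def set_encode_def sum_subtractf)

lemma skey_insert: "finite x \<Longrightarrow> i \<notin> x \<Longrightarrow> skey n (insert i x) = skey n x + (2 ^ i - 2 ^ Suc n)"
  by (simp add: skey_def)

text \<open>The constant \<open>2 ^ Suc n\<close> exceeds the encoding of every subset of
  \<open>{1..n}\<close>, so one extra element decides the comparison.\<close>

lemma skey_less_iff:
  assumes "x \<subseteq> {1..n}" "y \<subseteq> {1..n}"
  shows "skey n x < skey n y \<longleftrightarrow>
    card y < card x \<or> card x = card y \<and> set_encode x < set_encode y"
proof -
  have less: "skey n u < skey n v" if "u \<subseteq> {1..n}" "card v < card u" for u v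
  proof -
    have "u \<subseteq> {..<Suc n}" using that by auto
    then have "set_encode u < 2 ^ Suc n" by (rule set_encode_less_power)
    then have "int (set_encode u) < 2 ^ Suc n"
      by (metis of_nat_less_numeral_power_cancel_iff)
    moreover have "int (card v + 1) * 2 ^ Suc n \<le> int (card u) * 2 ^ Suc n"
      using that by (intro mult_right_mono) auto
    ultimately show ?thesis unfolding skey_eq by (simp add: algebra_simps)
  qed
  consider "card y < card x" | "card x < card y" | "card x = card y" by linarith
  then show ?thesis
  proof cases
    case 1 then show ?thesis using less[of x y] assms by simp
  next
    case 2 then show ?thesis using less[of y x] assms by simp
  next
    case 3 then show ?thesis unfolding skey_eq by simp
  qed
qed

lemma inj_on_skey: "inj_on (skey n) (Pow {1..n})"
proof (rule inj_onI)
  fix x y assume xy: "x \<in> Pow {1..n}" "y \<in> Pow {1..n}" "skey n x = skey n y"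
  then have fin: "finite x" "finite y" by (auto intro: finite_subset)
  have "card x = card y \<and> set_encode x = set_encode y"
    using xy skey_less_iff[of x n y] skey_less_iff[of y n x] by auto
  then show "x = y" using fin set_encode_eq by blast
qed

section \<open>Harper's theorem\<close>

definition flip :: "'a \<Rightarrow> 'a set \<Rightarrow> 'a set" where
  "flip j x = (if j \<in> x then x - {j} else insert j x)"

text \<open>The neighbourhood of radius one over an arbitrary ground set, because the induction for
  Harper's theorem removes coordinates. Iterating it over \<open>{1..n}\<close> gives
  \<open>nbhd\<close>.\<close>

definition nb :: "'a set \<Rightarrow> 'a set set \<Rightarrow> 'a set set" where
  "nb X A = {x. x \<subseteq> X \<and> (x \<in> A \<or> (\<exists>j\<in>X. flip j x \<in> A))}"

lemma nb_subset: "nb X A \<subseteq> Pow X"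
  by (auto simp: nb_def)

lemma nb_mono: "A \<subseteq> B \<Longrightarrow> nb X A \<subseteq> nb X B"
  by (auto simp: nb_def)

lemma flip_flip [simp]: "flip j (flip j x) = x"
  by (auto simp: flip_def)

text \<open>If \<open>y\<close> is reached by a step from \<open>z\<close> in \<open>I\<close> and
  \<open>x\<close> precedes \<open>y\<close>, then adding to \<open>x\<close> its smallest missing
  element gives a set that does not come after \<open>z\<close>.\<close>

lemma nb_initial:
  assumes X: "X \<subseteq> {1..n}" and I: "initial (skey n) (Pow X) I"
  shows "initial (skey n) (Pow X) (nb X I)"
  unfolding initial_def
proof (intro conjI ballI impI)
  show "nb X I \<subseteq> Pow X" by (rule nb_subset)
  fix y x assume y: "y \<in> nb X I" and x: "x \<in> Pow X" and less: "skey n x < skey n y"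
  have finX: "finite X" using X finite_subset by blast
  have yX: "y \<subseteq> X" using y by (auto simp: nb_def)
  have fin: "finite x" "finite y" using x yX finX finite_subset by auto
  have xn: "x \<subseteq> {1..n}" and yn: "y \<subseteq> {1..n}" using x yX X by auto
  have IX: "\<And>z. z \<in> I \<Longrightarrow> z \<subseteq> X" using initial_subset[OF I] by auto
  show "x \<in> nb X I"
  proof (cases "x \<in> I \<or> y \<in> I")
    case True
    then have "x \<in> I" using initialD[OF I _ x less] by blast
    then show ?thesis using x by (auto simp: nb_def)
  next
    case False
    then obtain j where j: "j \<in> X" "flip j y \<in> I" using y by (auto simp: nb_def)
    define z where "z = flip j y"
    have z: "z \<in> I" "z \<subseteq> X" using j IX z_def by auto
    have zn: "z \<subseteq> {1..n}" using z X by auto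
    have finz: "finite z" using z finX finite_subset by blast
    \<comment> \<open>Were \<open>j\<close> in \<open>y\<close>, the smaller set \<open>z\<close>
      would come after \<open>y\<close>, forcing \<open>y\<close> into \<open>I\<close>.\<close>
    have jy: "j \<notin> y"
    proof
      assume "j \<in> y"
      then have "card z < card y" using fin card_Diff1_less[of y j] unfolding z_def flip_def
        by simp
      then have "skey n y < skey n z" using skey_less_iff[OF yn zn] by simp
      then show False using initialD[OF I z(1)] yX False by blast
    qed
    then have zeq: "z = insert j y" by (simp add: z_def flip_def)
    have cz: "card z = Suc (card y)" using jy fin zeq by simp
    have cxy: "card y \<le> card x" using less skey_less_iff[OF xn yn] by auto
    \<comment> \<open>The full set is the first in the order, so it lies in the nonempty
      \<open>I\<close>.\<close>
    have "x \<noteq> X"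
    proof
      assume xX: "x = X"
      then have "card z \<le> card x" using z finX card_mono by blast
      moreover have "z = x" if "card z = card x"
        using that xX z finX card_subset_eq by blast
      ultimately have "skey n x < skey n z \<or> z = x" using skey_less_iff[OF xn zn] by linarith
      then show False using initialD[OF I z(1)] x False z(1) by blast
    qed
    then have ne: "X - x \<noteq> {}" using x by auto
    define d where "d = Min (X - x)"
    have d: "d \<in> X" "d \<notin> x" using Min_in[OF _ ne] finX d_def by auto
    have dmin: "i \<in> x" if "i \<in> X" "i < d" for i
      using that Min_le[of "X - x" i] finX unfolding d_def by (meson DiffI finite_Diff not_le)
    define x' where "x' = insert d x"
    have x': "x' \<subseteq> X" "finite x'" "card x' = Suc (card x)" "x' \<subseteq> {1..n}"
      using d x fin X by (auto simp: x'_def)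
    have "skey n x' < skey n z \<or> x' = z"
    proof (cases "card y < card x")
      case True
      then show ?thesis using x' cz skey_less_iff[OF x'(4) zn] by simp
    next
      case False
      then have ceq: "card x = card y" using cxy by simp
      then have enc: "set_encode x < set_encode y" using less skey_less_iff[OF xn yn] by auto
      then obtain m where m: "m \<in> y" "m \<notin> x" "\<And>i. i > m \<Longrightarrow> i \<in> x \<longleftrightarrow> i \<in> y"
        using set_encode_lessE[OF fin] by metis
      have dm: "d \<le> m" using dmin[of m] m yX by force
      have "set_encode x' < set_encode z \<or> x' = z"
      proof (cases "d \<le> j")
        case True
        then have "(2::nat) ^ d \<le> 2 ^ j" by simp
        then have "set_encode x' < set_encode z"
          using enc d fin jy unfolding x'_def zeq by (simp del: power_increasing_iff)
        then show ?thesis by simp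
      next
        case dj: False
        show ?thesis
        proof (cases "d = m")
          case True
          \<comment> \<open>Below \<open>d\<close> everything in \<open>X\<close> lies in
            \<open>x\<close>, and above \<open>m = d\<close> the sets \<open>x\<close> and
            \<open>y\<close> agree.\<close>
          have "z \<subseteq> x'"
          proof
            fix i assume "i \<in> z"
            then show "i \<in> x'"
              using m(3)[of i] dmin[of i] True dj z zeq unfolding x'_def
              by (cases i m rule: linorder_cases) auto
          qed
          then have "z = x'" using card_subset_eq[OF x'(2)] x'(3) cz ceq by simp
          then show ?thesis by simp
        next
          case False
          then have "set_encode x' < set_encode z"
            using m dm dj x' finz zeq by (intro set_encode_lessI[of x' z m]) (auto simp: x'_def)
          then show ?thesis by simp
        qed
      qed
      then show ?thesis using ceq cz x' skey_less_iff[OF x'(4) zn] by simp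
    qed
    then have "x' \<in> I" using initialD[OF I z(1)] x' z by auto
    then have "flip d x \<in> I" using d by (simp add: flip_def x'_def)
    then show ?thesis using d x by (auto simp: nb_def)
  qed
qed

section \<open>Coordinate sections and compression\<close>

definition sec0 :: "'a \<Rightarrow> 'a set set \<Rightarrow> 'a set set" where
  "sec0 j A = {x \<in> A. j \<notin> x}"

definition sec1 :: "'a \<Rightarrow> 'a set set \<Rightarrow> 'a set set" where
  "sec1 j A = {x. j \<notin> x \<and> insert j x \<in> A}"

lemma sec_decomp: "A = sec0 j A \<union> insert j ` sec1 j A"
proof -
  have "x \<in> insert j ` sec1 j A" if "x \<in> A" "j \<in> x" for x
    using that by (intro image_eqI[of _ _ "x - {j}"]) (auto simp: sec1_def insert_absorb)
  then show ?thesis by (auto simp: sec0_def sec1_def)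
qed

lemma inj_on_insert_fresh: "inj_on (insert j) {x. j \<notin> x}"
  by (rule inj_onI) (simp add: insert_ident)

lemma sec_joinI:
  assumes "\<And>x. x \<in> B0 \<union> B1 \<Longrightarrow> j \<notin> x"
  shows "sec0 j (B0 \<union> insert j ` B1) = B0" "sec1 j (B0 \<union> insert j ` B1) = B1"
  using assms by (auto simp: sec0_def sec1_def) (metis UnCI insert_ident)

lemma sec_subset:
  assumes "A \<subseteq> Pow X" shows "sec0 j A \<subseteq> Pow (X - {j})" "sec1 j A \<subseteq> Pow (X - {j})"
  using assms by (auto simp: sec0_def sec1_def)

lemma card_join:
  assumes "finite B0" "finite B1" "\<And>x. x \<in> B0 \<union> B1 \<Longrightarrow> j \<notin> x"
  shows "card (B0 \<union> insert j ` B1) = card B0 + card B1"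
proof -
  have "card (insert j ` B1) = card B1"
    using assms(3) by (intro card_image inj_on_subset[OF inj_on_insert_fresh]) auto
  moreover have "B0 \<inter> insert j ` B1 = {}" using assms(3) by auto
  ultimately show ?thesis using assms by (simp add: card_Un_disjoint)
qed

lemma card_sec:
  assumes "finite A"
  shows "card A = card (sec0 j A) + card (sec1 j A)"
proof -
  have "finite (sec0 j A)" using assms by (simp add: sec0_def)
  moreover have "finite (sec1 j A)"
  proof -
    have "insert j ` sec1 j A \<subseteq> A" by (auto simp: sec1_def)
    then have "finite (insert j ` sec1 j A)" using assms finite_subset by blast
    moreover have "inj_on (insert j) (sec1 j A)"
      by (rule inj_on_subset[OF inj_on_insert_fresh]) (auto simp: sec1_def)
    ultimately show ?thesis using finite_imageD by blast
  qed
  ultimately have "card (sec0 j A \<union> insert j ` sec1 j A) = card (sec0 j A) + card (sec1 j A)"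
    by (intro card_join) (auto simp: sec0_def sec1_def)
  then show ?thesis using sec_decomp[of A j] by simp
qed

text \<open>A flip of a coordinate other than \<open>j\<close> stays within a section, while
  flipping \<open>j\<close> moves to the other section.\<close>

lemma sec_nb:
  assumes "j \<in> X"
  shows "sec0 j (nb X A) = nb (X - {j}) (sec0 j A) \<union> (sec1 j A \<inter> Pow X)"
    and "sec1 j (nb X A) = nb (X - {j}) (sec1 j A) \<union> (sec0 j A \<inter> Pow X)"
proof -
  have j0: "flip j x = insert j x" "flip j (insert j x) = x" if "j \<notin> x" for x
    using that by (auto simp: flip_def)
  have ji: "flip i (insert j x) = insert j (flip i x)" "j \<notin> flip i x"
    if "j \<notin> x" "i \<noteq> j" for i x
    using that by (auto simp: flip_def)
  have ex: "(\<exists>i\<in>X. P i) \<longleftrightarrow> P j \<or> (\<exists>i\<in>X - {j}. P i)" for P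
    using assms by blast
  show "sec0 j (nb X A) = nb (X - {j}) (sec0 j A) \<union> (sec1 j A \<inter> Pow X)"
  proof (rule set_eqI)
    fix x
    show "x \<in> sec0 j (nb X A) \<longleftrightarrow> x \<in> nb (X - {j}) (sec0 j A) \<union> (sec1 j A \<inter> Pow X)"
    proof (cases "j \<in> x")
      case True
      then show ?thesis by (auto simp: sec0_def sec1_def nb_def)
    next
      case False
      have "(\<exists>i\<in>X - {j}. flip i x \<in> A) \<longleftrightarrow> (\<exists>i\<in>X - {j}. flip i x \<in> A \<and> j \<notin> flip i x)"
        using ji[OF False] by blast
      then show ?thesis
        using False j0[OF False] unfolding sec0_def sec1_def nb_def ex mem_Collect_eq by auto
    qed
  qed
  show "sec1 j (nb X A) = nb (X - {j}) (sec1 j A) \<union> (sec0 j A \<inter> Pow X)"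
  proof (rule set_eqI)
    fix x
    show "x \<in> sec1 j (nb X A) \<longleftrightarrow> x \<in> nb (X - {j}) (sec1 j A) \<union> (sec0 j A \<inter> Pow X)"
    proof (cases "j \<in> x")
      case True
      then show ?thesis by (auto simp: sec0_def sec1_def nb_def)
    next
      case False
      have "(\<exists>i\<in>X - {j}. flip i (insert j x) \<in> A) \<longleftrightarrow>
          (\<exists>i\<in>X - {j}. insert j (flip i x) \<in> A \<and> j \<notin> flip i x)"
        using ji[OF False] by auto
      then show ?thesis
        using False j0[OF False] assms unfolding sec0_def sec1_def nb_def ex mem_Collect_eq
        by auto
    qed
  qed
qed

text \<open>The correction term depends only on the size of \<open>B1\<close>, so it cancels when a
  section is replaced by another of equal size.\<close>

lemma sum_skey_join:
  assumes "finite X" "B0 \<subseteq> Pow (X - {j})" "B1 \<subseteq> Pow (X - {j})"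
  shows "sum (skey n) (B0 \<union> insert j ` B1) =
    sum (skey n) B0 + sum (skey n) B1 + int (card B1) * (2 ^ j - 2 ^ Suc n)"
proof -
  have fin: "finite B0" "finite B1" using assms finite_subset by (meson finite_Diff finite_Pow_iff)+
  have fresh: "j \<notin> x" "finite x" if "x \<in> B0 \<union> B1" for x
    using that assms finite_subset[of x X] by auto
  have "inj_on (insert j) B1"
    using fresh by (intro inj_on_subset[OF inj_on_insert_fresh]) auto
  then have "sum (skey n) (insert j ` B1) = (\<Sum>x\<in>B1. skey n x + (2 ^ j - 2 ^ Suc n))"
    using fresh by (subst sum.reindex) (auto intro!: sum.cong simp: skey_insert)
  moreover have "B0 \<inter> insert j ` B1 = {}" using fresh by auto
  ultimately show ?thesis using fin by (simp add: sum.union_disjoint sum.distrib)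
qed

lemma card_nb_sections:
  assumes "finite X" "j \<in> X" "A \<subseteq> Pow X"
  shows "card (nb X A) = card (nb (X - {j}) (sec0 j A) \<union> sec1 j A)
    + card (nb (X - {j}) (sec1 j A) \<union> sec0 j A)"
proof -
  have "finite (nb X A)" using nb_subset assms(1) finite_subset by (metis finite_Pow_iff)
  moreover have "sec1 j A \<inter> Pow X = sec1 j A" "sec0 j A \<inter> Pow X = sec0 j A"
    using sec_subset[OF assms(3), of j] by auto
  ultimately show ?thesis using card_sec[of "nb X A" j] sec_nb[OF assms(2), of A] by simp
qed

text \<open>Both sections are replaced by initial segments of the same sizes. At least one was not
  initial, so the key sum drops strictly.\<close>

lemma compression:
  assumes X: "X \<subseteq> {1..n}" and j: "j \<in> X" and A: "A \<subseteq> Pow X"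
    and IH: "\<And>I B. initial (skey n) (Pow (X - {j})) I \<Longrightarrow> B \<subseteq> Pow (X - {j}) \<Longrightarrow>
      card B = card I \<Longrightarrow> card (nb (X - {j}) I) \<le> card (nb (X - {j}) B)"
    and ne: "\<not> (initial (skey n) (Pow (X - {j})) (sec0 j A) \<and>
      initial (skey n) (Pow (X - {j})) (sec1 j A))"
  shows "\<exists>B \<subseteq> Pow X. card B = card A \<and> card (nb X B) \<le> card (nb X A) \<and>
    sum (skey n) B < sum (skey n) A"
proof -
  let ?Y = "X - {j}" let ?K = "skey n"
  have finX: "finite X" using X finite_subset by blast
  have Yn: "?Y \<subseteq> {1..n}" using X by auto
  have inj: "inj_on ?K (Pow ?Y)" using Yn by (intro inj_on_subset[OF inj_on_skey[of n]]) auto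
  have finP: "finite (Pow ?Y)" using finX by simp
  have sub: "sec0 j A \<subseteq> Pow ?Y" "sec1 j A \<subseteq> Pow ?Y" using sec_subset[OF A] by auto
  obtain B0 where B0: "initial ?K (Pow ?Y) B0" "card B0 = card (sec0 j A)"
    using initial_exists[OF finP inj] card_mono[OF finP sub(1)] by metis
  obtain B1 where B1: "initial ?K (Pow ?Y) B1" "card B1 = card (sec1 j A)"
    using initial_exists[OF finP inj] card_mono[OF finP sub(2)] by metis
  have B0s: "B0 \<subseteq> Pow ?Y" and B1s: "B1 \<subseteq> Pow ?Y" using initial_subset[OF B0(1)] initial_subset[OF B1(1)] .
  have finB: "finite B0" "finite B1" using finite_subset[OF B0s finP] finite_subset[OF B1s finP] .
  have finA: "finite (sec0 j A)" "finite (sec1 j A)" using finite_subset[OF sub(1) finP] finite_subset[OF sub(2) finP] .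
  define B where "B = B0 \<union> insert j ` B1"
  have secB: "sec0 j B = B0" "sec1 j B = B1"
    unfolding B_def using B0s B1s by (auto intro!: sec_joinI)
  have BX: "B \<subseteq> Pow X" using B0s B1s j by (auto simp: B_def)
  have finAX: "finite A" "finite B" using A BX finX finite_subset by (metis finite_Pow_iff)+
  have cardB: "card B = card A"
    using card_sec[OF finAX(1), of j] card_sec[OF finAX(2), of j] secB B0 B1 by simp
  \<comment> \<open>The neighbourhood of an initial segment is again initial, hence nested with
    \<open>D\<close>; the union is only as large as the larger of the two, which the induction
    hypothesis bounds.\<close>
  have le: "card (nb ?Y C \<union> D) \<le> card (nb ?Y C' \<union> D')"
    if C: "initial ?K (Pow ?Y) C" "card C = card C'" "C' \<subseteq> Pow ?Y"
      and D: "initial ?K (Pow ?Y) D" "card D = card D'" "D' \<subseteq> Pow ?Y" for C C' D D'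
  proof -
    have fin: "finite (nb ?Y C' \<union> D')"
      using finP nb_subset D(3) finite_subset by (metis finite_UnI)
    have "nb ?Y C \<subseteq> D \<or> D \<subseteq> nb ?Y C"
      using initial_nested[OF nb_initial[OF Yn C(1)] D(1) inj] .
    then have "card (nb ?Y C \<union> D) = card D \<or> card (nb ?Y C \<union> D) = card (nb ?Y C)"
      by (metis sup.absorb1 sup.absorb2)
    moreover have "card (nb ?Y C) \<le> card (nb ?Y C')" using IH[OF C(1) C(3)] C(2) by simp
    moreover have "card (nb ?Y C') \<le> card (nb ?Y C' \<union> D')" "card D' \<le> card (nb ?Y C' \<union> D')"
      using fin by (auto intro: card_mono)
    ultimately show ?thesis using D(2) by linarith
  qed
  have nbB: "card (nb X B) \<le> card (nb X A)"
    unfolding card_nb_sections[OF finX j BX] card_nb_sections[OF finX j A] secB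
    using B0 B1 sub by (intro add_mono le) auto
  have s0: "sum ?K B0 \<le> sum ?K (sec0 j A)" "sec0 j A \<noteq> B0 \<Longrightarrow> sum ?K B0 < sum ?K (sec0 j A)"
    using initial_sum_less[OF B0(1) inj finP sub(1)] B0(2) by force+
  have s1: "sum ?K B1 \<le> sum ?K (sec1 j A)" "sec1 j A \<noteq> B1 \<Longrightarrow> sum ?K B1 < sum ?K (sec1 j A)"
    using initial_sum_less[OF B1(1) inj finP sub(2)] B1(2) by force+
  have "sec0 j A \<noteq> B0 \<or> sec1 j A \<noteq> B1" using ne B0(1) B1(1) by auto
  then have "sum ?K B0 + sum ?K B1 < sum ?K (sec0 j A) + sum ?K (sec1 j A)"
    using s0 s1 by linarith
  moreover have "sum ?K A = sum ?K (sec0 j A) + sum ?K (sec1 j A)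
      + int (card (sec1 j A)) * (2 ^ j - 2 ^ Suc n)"
    using sum_skey_join[OF finX sub] sec_decomp[of A j] by simp
  moreover have "sum ?K B = sum ?K B0 + sum ?K B1 + int (card B1) * (2 ^ j - 2 ^ Suc n)"
    using sum_skey_join[OF finX B0s B1s] B_def by simp
  ultimately have "sum ?K B < sum ?K A" using B1(2) by simp
  then show ?thesis using BX cardB nbB by blast
qed

text \<open>In a family all of whose sections are initial segments, a pair violating initiality
  must be a pair of complementary sets that are neighbours in the order, and exchanging the two
  does not enlarge the neighbourhood.\<close>

lemma antipodal_exchange:
  assumes X: "X \<subseteq> {1..n}" and A: "A \<subseteq> Pow X"
    and xy: "x \<notin> A" "y \<in> A" "x \<subseteq> X" "skey n x < skey n y" "y = X - x"
    and below: "\<And>z. z \<subseteq> X \<Longrightarrow> skey n z < skey n x \<Longrightarrow> z \<in> A"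
    and cons: "\<And>z. z \<subseteq> X \<Longrightarrow> skey n x < skey n z \<Longrightarrow> skey n y \<le> skey n z"
  shows "nb X (insert x (A - {y})) \<subseteq> nb X A"
proof -
  have finX: "finite X" using X finite_subset by blast
  have fin: "finite x" "finite y" using xy finX finite_subset by auto
  have Pn: "z \<subseteq> {1..n}" if "z \<subseteq> X" for z using that X by auto
  have yX: "y \<subseteq> X" using xy by auto
  note kless = skey_less_iff[OF Pn Pn]
  have keq: "z = w" if "skey n z = skey n w" "z \<subseteq> X" "w \<subseteq> X" for z w
    using inj_onD[OF inj_on_skey] that Pn by auto
  have cxy: "card y \<le> card x" using kless[OF xy(3) yX] xy(4) by auto
  have up: "insert j x \<in> A" if "j \<in> y" for j
  proof (rule below)
    show "insert j x \<subseteq> X" using that xy by auto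
    then show "skey n (insert j x) < skey n x" using kless[of "insert j x" x] that xy fin by auto
  qed
  \<comment> \<open>The empty set is last in the order and \<open>x - {l}\<close> comes after
    \<open>x\<close>; with nothing between \<open>x\<close> and \<open>y\<close> the two
    coincide.\<close>
  have last: "x - {l} = y" if "y = {}" "l \<in> x" for l
  proof (rule keq)
    have sub: "x - {l} \<subseteq> X" using xy by auto
    have "skey n x < skey n (x - {l})"
      using kless[OF xy(3) sub] that fin card_Diff1_less[of x l] by auto
    then have "skey n y \<le> skey n (x - {l})" using cons[OF sub] by simp
    moreover have "\<not> skey n y < skey n (x - {l})"
    proof (cases "x - {l} = {}")
      case True
      then show ?thesis using that(1) by (metis less_irrefl)
    next
      case False
      then show ?thesis using kless[OF yX sub] that(1) fin(1) by auto
    qed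
    ultimately show "skey n (x - {l}) = skey n y" by simp
  qed (use xy yX in auto)
  have x_in: "x \<in> nb X A"
  proof (cases "y = {}")
    case False
    then obtain j where j: "j \<in> y" by auto
    then have "flip j x \<in> A" using up[OF j] xy by (auto simp: flip_def)
    then show ?thesis using j yX xy by (auto simp: nb_def)
  next
    case True
    then have "x \<noteq> {}" using xy(4) by auto
    then obtain l where l: "l \<in> x" by auto
    have "x - {l} = y" using last[OF True l] .
    then have "flip l x \<in> A" using l xy by (auto simp: flip_def)
    then show ?thesis using l xy by (auto simp: nb_def)
  qed
  have down_in: "x - {l} \<in> nb X A" if l: "l \<in> x" for l
  proof (cases "\<exists>j\<in>y. j < l")
    case True
    then obtain j where j: "j \<in> y" "j < l" by auto
    let ?z = "insert j (x - {l})"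
    have jx: "j \<notin> x" using j xy by auto
    have zX: "?z \<subseteq> X" using j yX xy by auto
    have "set_encode ?z < set_encode x"
      using j l jx fin by (intro set_encode_lessI[of _ _ l]) auto
    moreover have "card ?z = card x" using jx card_Suc_Diff1[OF fin(1) l] fin by simp
    ultimately have "?z \<in> A" using below[OF zX] kless[OF zX xy(3)] by simp
    then have "flip j (x - {l}) \<in> A" using jx by (simp add: flip_def)
    then show ?thesis using j yX xy by (auto simp: nb_def)
  next
    case False
    \<comment> \<open>In this case every element of \<open>y\<close> exceeds \<open>l\<close>, so
      the swapped set comes after \<open>x\<close>, and nothing lies strictly between
      \<open>x\<close> and \<open>y\<close>.\<close>
    have noswap: "\<not> skey n (insert j (x - {l})) < skey n y" if j: "j \<in> y" for j
    proof
      let ?z = "insert j (x - {l})"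
      assume less: "skey n ?z < skey n y"
      have jx: "j \<notin> x" using j xy by auto
      have zX: "?z \<subseteq> X" using j yX xy by auto
      have "l < j" using False j l jx by (metis linorder_neqE_nat)
      then have "set_encode x < set_encode ?z"
        using j l jx fin by (intro set_encode_lessI[of _ _ j]) auto
      moreover have "card ?z = card x" using jx card_Suc_Diff1[OF fin(1) l] fin by simp
      ultimately have "skey n x < skey n ?z" using kless[OF xy(3) zX] by simp
      then show False using cons[OF zX] less by simp
    qed
    have cz: "card (insert j (x - {l})) = card x" if "j \<in> y" for j
      using that xy(5) card_Suc_Diff1[OF fin(1) l] fin by simp
    have zX: "insert j (x - {l}) \<subseteq> X" if "j \<in> y" for j using that xy yX by auto
    show ?thesis
    proof (cases "card y < card x")
      case True
      \<comment> \<open>A nonempty \<open>y\<close> would allow a swap; the result has the size of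
        \<open>x\<close>, larger than that of \<open>y\<close>, and so would precede
        \<open>y\<close>.\<close>
      then have "y = {}" using noswap kless[OF zX yX] cz by auto
      then have "x - {l} = y" using last l by blast
      then show ?thesis using xy yX by (auto simp: nb_def)
    next
      case False
      then have ceq: "card x = card y" using cxy by simp
      then have enc: "set_encode x < set_encode y" using xy(4) kless[OF xy(3) yX] by simp
      then obtain m where m: "m \<in> y" "m \<notin> x" "\<And>i. i > m \<Longrightarrow> i \<in> x \<longleftrightarrow> i \<in> y"
        using set_encode_lessE[OF fin] by metis
      have top: "i \<le> m" if "i \<in> X" for i using m(3)[of i] that xy by force
      \<comment> \<open>Since \<open>m\<close> is the top element of \<open>X\<close>, swapping in a
        second element of \<open>y\<close> would give a set without \<open>m\<close>, which precedes
        \<open>y\<close>.\<close>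
      have ym: "y = {m}"
      proof (rule ccontr)
        assume "y \<noteq> {m}"
        then obtain j where j: "j \<in> y" "j \<noteq> m" using m(1) by auto
        have "i \<in> insert j (x - {l}) \<longleftrightarrow> i \<in> y" if "i > m" for i
          using top[of i] that zX[OF j(1)] yX by auto
        then have "set_encode (insert j (x - {l})) < set_encode y"
          using m(1,2) j fin by (intro set_encode_lessI[of _ _ m]) auto
        then show False using noswap[OF j(1)] kless[OF zX[OF j(1)] yX] cz[OF j(1)] ceq by simp
      qed
      then have "card x = 1" using ceq by simp
      then have "x - {l} = {}" using l by (metis card_1_singletonE Diff_cancel singletonD)
      moreover have "flip m {} \<in> A" using ym xy(2) by (simp add: flip_def)
      then have "{} \<in> nb X A" using m(1) yX by (auto simp: nb_def)
      ultimately show ?thesis by metis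
    qed
  qed
  show ?thesis
  proof
    fix z assume "z \<in> nb X (insert x (A - {y}))"
    then have zX: "z \<subseteq> X" and "z \<in> insert x (A - {y}) \<or> (\<exists>j\<in>X. flip j z \<in> insert x (A - {y}))"
      by (auto simp: nb_def)
    then consider "z \<in> nb X A" | "z = x" | j where "j \<in> X" "flip j z = x"
      by (auto simp: nb_def)
    then show "z \<in> nb X A"
    proof cases
      case 3
      then have z: "z = flip j x" by (metis flip_flip)
      show ?thesis
      proof (cases "j \<in> x")
        case True then show ?thesis using down_in z by (simp add: flip_def)
      next
        case False
        then have "z \<in> A" using up[of j] z 3 xy by (simp add: flip_def)
        then show ?thesis using zX by (auto simp: nb_def)
      qed
    qed (use x_in in auto)
  qed
qed

text \<open>A family of least key sum among the competitors must be compressed in every coordinate.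
  It can then fail to be initial only through a complementary pair, and exchanging that pair would
  lower the sum again.\<close>

theorem harper:
  assumes "X \<subseteq> {1..n}" "initial (skey n) (Pow X) I" "B \<subseteq> Pow X" "card B = card I"
  shows "card (nb X I) \<le> card (nb X B)"
  using assms
proof (induction "card X" arbitrary: X I B rule: less_induct)
  case less
  let ?K = "skey n"
  have finX: "finite X" using less.prems(1) finite_subset by blast
  have finP: "finite (Pow X)" using finX by simp
  have inj: "inj_on ?K (Pow X)" using less.prems(1) by (intro inj_on_subset[OF inj_on_skey[of n]]) auto
  \<comment> \<open>\<open>B\<close> itself is a member; the member of least key sum will turn out
    to be \<open>I\<close>.\<close>
  define S where "S = {A. A \<subseteq> Pow X \<and> card A = card I \<and> card (nb X A) \<le> card (nb X B)}"
  have "finite S" "B \<in> S" using finP less.prems by (auto simp: S_def)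
  then obtain A where A: "A \<in> S" and Amin: "\<And>C. C \<in> S \<Longrightarrow> sum ?K A \<le> sum ?K C"
    using ex_is_arg_min_if_finite[of S "sum ?K"] by (auto simp: is_arg_min_def not_less)
  have AX: "A \<subseteq> Pow X" and cA: "card A = card I" and nA: "card (nb X A) \<le> card (nb X B)"
    using A by (auto simp: S_def)
  have secs: "initial ?K (Pow (X - {j})) (sec0 j A) \<and> initial ?K (Pow (X - {j})) (sec1 j A)"
    if j: "j \<in> X" for j
  proof (rule ccontr)
    assume ne: "\<not> ?thesis"
    have IH: "card (nb (X - {j}) I) \<le> card (nb (X - {j}) B)"
      if "initial ?K (Pow (X - {j})) I" "B \<subseteq> Pow (X - {j})" "card B = card I" for I B
      using that less.hyps[of "X - {j}" I B] card_Diff1_less[OF finX j] less.prems(1) by blast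
    obtain C where "C \<subseteq> Pow X" "card C = card A" "card (nb X C) \<le> card (nb X A)"
        "sum ?K C < sum ?K A"
      using compression[OF less.prems(1) j AX IH ne] by blast
    then show False using Amin[of C] cA nA by (auto simp: S_def)
  qed
  \<comment> \<open>If \<open>x\<close> and \<open>y\<close> agreed at \<open>j\<close>, both would
    lie in the same \<open>j\<close>-section. Additivity of the key preserves their comparison
    there, so initiality of that section would put \<open>x\<close> into \<open>A\<close>.\<close>
  have anti: "y = X - x" if x: "x \<notin> A" "x \<subseteq> X" and y: "y \<in> A" and xy: "?K x < ?K y" for x y
  proof -
    have yX: "y \<subseteq> X" using y AX by auto
    have fin: "finite x" "finite y" using x yX finX finite_subset by auto
    have "j \<in> y \<longleftrightarrow> j \<notin> x" if j: "j \<in> X" for j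
    proof (rule ccontr)
      assume "\<not> ?thesis"
      then consider "j \<in> x" "j \<in> y" | "j \<notin> x" "j \<notin> y" by auto
      then show False
      proof cases
        case 1
        have "?K x = ?K (x - {j}) + (2 ^ j - 2 ^ Suc n)" "?K y = ?K (y - {j}) + (2 ^ j - 2 ^ Suc n)"
          using skey_insert[of "x - {j}" j n] skey_insert[of "y - {j}" j n] 1 fin
          by (auto simp: insert_absorb)
        then have "?K (x - {j}) < ?K (y - {j})" using xy by simp
        moreover have "y - {j} \<in> sec1 j A" using 1 y by (auto simp: sec1_def insert_absorb)
        ultimately have "x - {j} \<in> sec1 j A"
          using initialD[OF conjunct2[OF secs[OF j]], of "y - {j}" "x - {j}"] x by auto
        then show False using 1 x by (simp add: sec1_def insert_absorb)
      next
        case 2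
        have "y \<in> sec0 j A" "x \<in> Pow (X - {j})" using 2 y x by (auto simp: sec0_def)
        then have "x \<in> sec0 j A" using initialD[OF conjunct1[OF secs[OF j]] _ _ xy] by simp
        then show False using x by (simp add: sec0_def)
      qed
    qed
    then show ?thesis using yX by blast
  qed
  have "initial ?K (Pow X) A"
  proof (rule ccontr)
    assume "\<not> ?thesis"
    then obtain x y where xy: "x \<notin> A" "y \<in> A" "x \<subseteq> X" "?K x < ?K y"
      using AX by (auto simp: initial_def)
    have y: "y = X - x" using anti xy by blast
    have yX: "y \<subseteq> X" using y by auto
    have below: "z \<in> A" if "z \<subseteq> X" "?K z < ?K x" for z
    proof (rule ccontr)
      assume "z \<notin> A"
      then have "y = X - z" using anti[of z y] that xy by simp
      then have "z = x" using y that(1) xy(3) by blast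
      then show False using that by simp
    qed
    \<comment> \<open>A set strictly between would be the complement of \<open>x\<close> if it is in
      \<open>A\<close>, and of \<open>y\<close> otherwise, hence equal to \<open>y\<close> or to
      \<open>x\<close>.\<close>
    have cons: "?K y \<le> ?K z" if z: "z \<subseteq> X" "?K x < ?K z" for z
    proof (rule ccontr)
      assume less: "\<not> ?thesis"
      show False
      proof (cases "z \<in> A")
        case True
        then have "z = y" using anti[of x z] xy z y by simp
        then show False using less by simp
      next
        case False
        then have "y = X - z" using anti[of z y] z xy less by simp
        then have "z = x" using y z(1) xy(3) by blast
        then show False using z by simp
      qed
    qed
    define C where "C = insert x (A - {y})"
    have finA: "finite A" using AX finP finite_subset by blast
    have "nb X C \<subseteq> nb X A"
      unfolding C_def by (rule antipodal_exchange[OF less.prems(1) AX xy y below cons])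
    then have "card (nb X C) \<le> card (nb X A)"
      using nb_subset[of X A] finP by (meson card_mono finite_subset)
    moreover have "card C = card A" using xy(1) card_Suc_Diff1[OF finA xy(2)] finA by (simp add: C_def)
    moreover have "C \<subseteq> Pow X" using AX xy by (auto simp: C_def)
    ultimately have "sum ?K A \<le> sum ?K C" using Amin[of C] cA nA by (auto simp: S_def)
    moreover have "sum ?K C = ?K x + sum ?K (A - {y})" using xy(1) finA by (simp add: C_def)
    moreover have "sum ?K A = ?K y + sum ?K (A - {y})" using sum.remove[OF finA xy(2)] .
    ultimately show False using xy(4) by simp
  qed
  then have "A = I"
    using initial_card_subset[OF _ less.prems(2) inj finP] initial_card_subset[OF less.prems(2) _ inj finP] cA
    by (simp add: subset_antisym)
  then show ?case using nA by simp
qed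

lemma cube_finite: "finite (cube n)" "x \<in> cube n \<Longrightarrow> finite x"
  unfolding cube_def by (simp, metis Pow_iff finite_atLeastAtMost finite_subset)

section \<open>Neighbourhoods of arbitrary radius in the cube\<close>

lemma nbhd_subset: "nbhd n t A \<subseteq> cube n"
  by (auto simp: nbhd_def)

lemma finite_nbhd: "finite (nbhd n t A)"
  using finite_subset[OF nbhd_subset cube_finite(1)] .

lemma nbhd_mono: "A \<subseteq> B \<Longrightarrow> t \<le> u \<Longrightarrow> nbhd n t A \<subseteq> nbhd n u B"
  unfolding nbhd_def by (blast intro: le_trans)

lemma nbhd_0: "A \<subseteq> cube n \<Longrightarrow> nbhd n 0 A = A"
proof -
  assume A: "A \<subseteq> cube n"
  have "hdist x y = 0 \<longleftrightarrow> x = y" if "x \<in> cube n" "y \<in> cube n" for x y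
    using that cube_finite(2) by (auto simp: hdist_def)
  then show ?thesis using A by (fastforce simp: nbhd_def)
qed

lemma hdist_flip:
  assumes "finite x" "finite y"
  shows "hdist (flip j x) y = (if j \<in> x \<longleftrightarrow> j \<in> y then Suc (hdist x y) else hdist x y - 1)"
proof (cases "j \<in> x \<longleftrightarrow> j \<in> y")
  case True
  then have "(flip j x - y) \<union> (y - flip j x) = insert j ((x - y) \<union> (y - x))"
    by (auto simp: flip_def)
  moreover have "j \<notin> (x - y) \<union> (y - x)" using True by auto
  ultimately show ?thesis using True assms by (simp add: hdist_def)
next
  case False
  then have "(flip j x - y) \<union> (y - flip j x) = ((x - y) \<union> (y - x)) - {j}"
    by (auto simp: flip_def)
  moreover have "j \<in> (x - y) \<union> (y - x)" using False by auto
  ultimately show ?thesis using False assms by (simp add: hdist_def)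
qed

text \<open>Flipping a coordinate of the symmetric difference brings \<open>x\<close> one step
  closer to \<open>y\<close>, and no flip changes the distance by more than one.\<close>

lemma nbhd_Suc:
  assumes "A \<subseteq> cube n"
  shows "nbhd n (Suc t) A = nb {1..n} (nbhd n t A)"
proof (intro set_eqI iffI)
  fix x assume "x \<in> nbhd n (Suc t) A"
  then obtain y where x: "x \<in> cube n" and y: "y \<in> A" "hdist x y \<le> Suc t" by (auto simp: nbhd_def)
  have yc: "y \<in> cube n" using y assms by auto
  have fin: "finite x" "finite y" using x yc cube_finite(2) by auto
  show "x \<in> nb {1..n} (nbhd n t A)"
  proof (cases "hdist x y \<le> t")
    case True
    then show ?thesis using x y by (auto simp: nb_def nbhd_def cube_def)
  next
    case False
    then have "hdist x y \<noteq> 0" by simp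
    then obtain j where j: "j \<in> (x - y) \<union> (y - x)" 
      unfolding hdist_def by (metis card.empty ex_in_conv)
    then have "hdist (flip j x) y \<le> t" using hdist_flip[OF fin, of j] y by auto
    moreover have "j \<in> {1..n}" using j x yc unfolding cube_def by blast
    moreover have "flip j x \<in> cube n" using x \<open>j \<in> {1..n}\<close> unfolding cube_def flip_def by auto
    ultimately show ?thesis using x y unfolding nb_def nbhd_def cube_def by blast
  qed
next
  fix x assume "x \<in> nb {1..n} (nbhd n t A)"
  then consider "x \<in> nbhd n t A" | j where "x \<in> cube n" "j \<in> {1..n}" "flip j x \<in> nbhd n t A"
    by (auto simp: nb_def cube_def)
  then show "x \<in> nbhd n (Suc t) A"
  proof cases
    case 1
    then show ?thesis using nbhd_mono[of A A t "Suc t" n] by auto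
  next
    case 2
    then obtain y where y: "y \<in> A" "hdist (flip j x) y \<le> t" by (auto simp: nbhd_def)
    have "finite x" "finite y" using 2 y assms cube_finite(2) by auto
    then have "hdist x y \<le> Suc t" using hdist_flip[of x y j] y by (auto split: if_splits)
    then show ?thesis using 2 y by (auto simp: nbhd_def)
  qed
qed

lemma initial_nbhd:
  assumes "initial (skey n) (cube n) I"
  shows "initial (skey n) (cube n) (nbhd n t I)"
proof (induction t)
  case 0
  then show ?case using assms nbhd_0 initial_subset by metis
next
  case (Suc t)
  then show ?case
    using nbhd_Suc[OF initial_subset[OF assms]] nb_initial[of "{1..n}" n] by (simp add: cube_def)
qed

lemma initial_nbhd_minimal:
  assumes I: "initial (skey n) (cube n) I"
  shows "nbhd_minimal n t I"
  unfolding nbhd_minimal_def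
proof (intro allI impI, elim conjE)
  fix B assume B: "B \<subseteq> cube n" "card B = card I"
  show "card (nbhd n t I) \<le> card (nbhd n t B)"
  proof (induction t)
    case 0
    then show ?case using B nbhd_0 initial_subset[OF I] by simp
  next
    case (Suc t)
    \<comment> \<open>Harper's theorem compares families of equal size, so the possibly larger
      neighbourhood of \<open>B\<close> is first cut down.\<close>
    then obtain C where C: "C \<subseteq> nbhd n t B" "card C = card (nbhd n t I)"
      by (metis obtain_subset_with_card_n)
    have "C \<subseteq> Pow {1..n}" using C nbhd_subset[of n t B] by (auto simp: cube_def)
    then have "card (nb {1..n} (nbhd n t I)) \<le> card (nb {1..n} C)"
      using harper[of "{1..n}" n] initial_nbhd[OF I, of t] C(2) by (simp add: cube_def)
    also have "\<dots> \<le> card (nb {1..n} (nbhd n t B))"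
      using nb_mono[OF C(1)] finite_subset[OF nb_subset] by (intro card_mono) auto
    finally show ?case using nbhd_Suc[OF B(1)] nbhd_Suc[OF initial_subset[OF I]] by simp
  qed
qed

section \<open>Automorphisms of the cube\<close>

definition cmap :: "(nat \<Rightarrow> nat) \<Rightarrow> nat set \<Rightarrow> nat set \<Rightarrow> nat set" where
  "cmap \<sigma> I x = ((\<sigma> ` x) - I) \<union> (I - (\<sigma> ` x))"

lemma cube_iso_iff:
  "cube_iso n A B \<longleftrightarrow> (\<exists>\<sigma> I. bij_betw \<sigma> {1..n} {1..n} \<and> I \<subseteq> {1..n} \<and> cmap \<sigma> I ` A = B)"
  by (simp add: cube_iso_def cmap_def)

lemma cmap_bij:
  assumes \<sigma>: "bij_betw \<sigma> {1..n} {1..n}" and I: "I \<subseteq> {1..n}"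
  shows "bij_betw (cmap \<sigma> I) (cube n) (cube n)"
proof -
  have sub: "cmap \<sigma> I ` cube n \<subseteq> cube n"
    using bij_betw_imp_surj_on[OF \<sigma>] I by (auto simp: cmap_def cube_def)
  have inj: "inj_on (cmap \<sigma> I) (cube n)"
  proof (rule inj_onI)
    fix x y assume xy: "x \<in> cube n" "y \<in> cube n" "cmap \<sigma> I x = cmap \<sigma> I y"
    then have "\<sigma> ` x = \<sigma> ` y" unfolding cmap_def by blast
    then show "x = y" using inj_on_image_eq_iff[OF bij_betw_imp_inj_on[OF \<sigma>]] xy
      by (auto simp: cube_def)
  qed
  show ?thesis
    unfolding bij_betw_def using inj endo_inj_surj[OF cube_finite(1) sub inj] by simp
qed

text \<open>The translation by \<open>I\<close> cancels in the symmetric difference, and the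
  injective image keeps its size.\<close>

lemma hdist_cmap:
  assumes \<sigma>: "bij_betw \<sigma> {1..n} {1..n}" and "x \<in> cube n" "y \<in> cube n"
  shows "hdist (cmap \<sigma> I x) (cmap \<sigma> I y) = hdist x y"
proof -
  have inj: "inj_on \<sigma> {1..n}" using \<sigma> bij_betw_imp_inj_on by blast
  have xy: "x \<subseteq> {1..n}" "y \<subseteq> {1..n}" using assms by (auto simp: cube_def)
  have "(cmap \<sigma> I x - cmap \<sigma> I y) \<union> (cmap \<sigma> I y - cmap \<sigma> I x) = (\<sigma> ` x - \<sigma> ` y) \<union> (\<sigma> ` y - \<sigma> ` x)"
    unfolding cmap_def by blast
  also have "\<dots> = \<sigma> ` ((x - y) \<union> (y - x))"
    using inj_on_image_set_diff[OF inj, of x y] inj_on_image_set_diff[OF inj, of y x] xy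
    by (auto simp: image_Un)
  finally show ?thesis
    unfolding hdist_def using inj_on_subset[OF inj, of "(x - y) \<union> (y - x)"] xy
    by (metis Diff_subset Un_least card_image order_trans)
qed

lemma cube_iso_card_nbhd:
  assumes "cube_iso n A B" "A \<subseteq> cube n"
  shows "card (nbhd n t A) = card (nbhd n t B)" "card A = card B" "B \<subseteq> cube n"
    "cube_iso n (cube n - A) (cube n - B)"
proof -
  obtain \<sigma> I where \<sigma>: "bij_betw \<sigma> {1..n} {1..n}" "I \<subseteq> {1..n}" and B: "cmap \<sigma> I ` A = B"
    using assms(1) by (auto simp: cube_iso_iff)
  let ?f = "cmap \<sigma> I"
  have bij: "bij_betw ?f (cube n) (cube n)" using cmap_bij[OF \<sigma>] .
  have inj: "inj_on ?f (cube n)" and surj: "?f ` cube n = cube n"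
    using bij by (auto simp: bij_betw_def)
  show "B \<subseteq> cube n" using B surj assms(2) by auto
  show "card A = card B" using B inj assms(2) by (metis card_image inj_on_subset)
  have "?f ` nbhd n t A = nbhd n t B"
  proof (intro set_eqI iffI)
    fix z assume "z \<in> ?f ` nbhd n t A"
    then obtain x y where "z = ?f x" "x \<in> cube n" "y \<in> A" "hdist x y \<le> t"
      by (auto simp: nbhd_def)
    moreover then have "hdist (?f x) (?f y) \<le> t" using hdist_cmap[OF \<sigma>(1)] assms(2) by auto
    ultimately show "z \<in> nbhd n t B" using B surj by (auto simp: nbhd_def)
  next
    fix z assume "z \<in> nbhd n t B"
    then obtain w where w: "z \<in> cube n" "w \<in> B" "hdist z w \<le> t" by (auto simp: nbhd_def)
    obtain x where x: "x \<in> cube n" "z = ?f x" using w surj by auto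
    obtain y where y: "y \<in> A" "w = ?f y" using w B by auto
    then have "hdist x y \<le> t" using w x hdist_cmap[OF \<sigma>(1)] assms(2) by auto
    then show "z \<in> ?f ` nbhd n t A" using x y by (auto simp: nbhd_def)
  qed
  then show "card (nbhd n t A) = card (nbhd n t B)"
    by (metis card_image inj_on_subset[OF inj nbhd_subset])
  have "?f ` (cube n - A) = cube n - B"
    using inj_on_image_set_diff[OF inj, of "cube n" A] assms(2) surj B by auto
  then show "cube_iso n (cube n - A) (cube n - B)" using \<sigma> by (auto simp: cube_iso_iff)
qed

lemma cube_iso_minimal:
  assumes "cube_iso n A B" "A \<subseteq> cube n" "nbhd_minimal n t B"
  shows "nbhd_minimal n t A"
  using assms(3) unfolding nbhd_minimal_def cube_iso_card_nbhd(1,2)[OF assms(1,2)] .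

lemma cube_iso_extremal:
  assumes "cube_iso n A B" "A \<subseteq> cube n" "extremal n B"
  shows "extremal n A"
  using assms(3) cube_iso_minimal[OF assms(1,2)]
    cube_iso_minimal[OF cube_iso_card_nbhd(4)[OF assms(1,2)] Diff_subset]
  by (simp add: extremal_def)

section \<open>Shadows and the neighbourhoods of the candidate sets\<close>

definition upper :: "nat \<Rightarrow> nat \<Rightarrow> nat set set" where
  "upper n s = {x \<in> cube n. s < card x}"

text \<open>For a family of \<open>s\<close>-sets and \<open>l \<le> s\<close> this is the lower
  shadow iterated \<open>s - l\<close> times, given directly by containment.\<close>

definition down :: "nat \<Rightarrow> 'a set set \<Rightarrow> 'a set set" where
  "down l F = {x. card x = l \<and> (\<exists>z\<in>F. x \<subseteq> z)}"

text \<open>Complementation turns the upper shadows of the \<open>s\<close>-sets outside \<open>F\<close> into the lower shadows of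
  the dual family.\<close>

definition dual :: "nat set \<Rightarrow> nat \<Rightarrow> nat set set \<Rightarrow> nat set set" where
  "dual X s F = {z. z \<subseteq> X \<and> X - z \<in> layer X s - F}"

lemma layerD: "finite X \<Longrightarrow> x \<in> layer X s \<Longrightarrow> x \<subseteq> X \<and> card x = s \<and> finite x"
  by (auto simp: layer_def intro: finite_subset)

lemma finite_layer: "finite X \<Longrightarrow> finite (layer X s)"
  by (simp add: layer_def)

lemma dual_layer:
  assumes "finite X" shows "dual X s F \<subseteq> layer X (card X - s)"
proof
  fix z assume "z \<in> dual X s F"
  then have z: "z \<subseteq> X" "card (X - z) = s" by (auto simp: dual_def layer_def)
  then have "card z = card X - s"
    using card_Diff_subset[of z X] card_mono[of X z] assms finite_subset[of z X] by auto
  then show "z \<in> layer X (card X - s)" using z by (simp add: layer_def)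
qed

lemma dual_dual:
  assumes "finite X" "F \<subseteq> layer X s" "s \<le> card X"
  shows "dual X (card X - s) (dual X s F) = F"
proof (rule set_eqI)
  fix z
  show "z \<in> dual X (card X - s) (dual X s F) \<longleftrightarrow> z \<in> F"
  proof (cases "z \<subseteq> X")
    case False
    then show ?thesis using assms(2) by (auto simp: dual_def layer_def)
  next
    case True
    have "card (X - z) = card X - card z" "card z \<le> card X"
      using True assms(1) card_Diff_subset[of z X] card_mono[of X z] finite_subset[of z X] by auto
    then have "card (X - z) = card X - s \<longleftrightarrow> card z = s" using assms(3) by linarith
    moreover have "X - (X - z) = z" using True by auto
    moreover have "z \<in> F \<Longrightarrow> card z = s" using assms(2) by (auto simp: layer_def)
    ultimately show ?thesis using True unfolding dual_def layer_def by auto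
  qed
qed

lemma mem_A_i:
  assumes "F \<subseteq> layer {1..n} s"
  shows "x \<in> A_i n s F i \<longleftrightarrow> x \<in> cube n \<and> (s < card x \<or> i \<notin> x \<and> (x \<in> F \<or> insert i x \<in> F))"
proof -
  have "card x = s" if "x \<in> F" using that assms by (auto simp: layer_def)
  moreover have "card x + 1 = s" if "insert i x \<in> F" "i \<notin> x"
  proof -
    have "finite (insert i x)" "card (insert i x) = s"
      using that assms layerD[of "{1..n}" "insert i x" s] by auto
    then show ?thesis using that by auto
  qed
  ultimately show ?thesis by (auto simp: A_i_def cube_def)
qed

lemma A_i_subset: "A_i n s F i \<subseteq> cube n"
  by (auto simp: A_i_def cube_def)

text \<open>Writing the two lower parts of \<open>A_i\<close> as one image under deletion of
  \<open>i\<close> makes counting and permuting coordinates immediate.\<close>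

lemma A_i_eq:
  assumes "F \<subseteq> layer {1..n} s"
  shows "A_i n s F i = upper n s \<union> (\<lambda>z. z - {i}) ` F"
proof (rule set_eqI)
  fix x
  have "x \<in> (\<lambda>z. z - {i}) ` F \<longleftrightarrow> i \<notin> x \<and> (x \<in> F \<or> insert i x \<in> F)"
  proof
    assume "x \<in> (\<lambda>z. z - {i}) ` F"
    then obtain z where "z \<in> F" "x = z - {i}" by auto
    then show "i \<notin> x \<and> (x \<in> F \<or> insert i x \<in> F)" by (cases "i \<in> z") (auto simp: insert_absorb)
  next
    assume "i \<notin> x \<and> (x \<in> F \<or> insert i x \<in> F)"
    then show "x \<in> (\<lambda>z. z - {i}) ` F"
      by (auto intro: image_eqI[of _ _ x] image_eqI[of _ _ "insert i x"])
  qed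
  moreover have "x \<in> cube n" if "i \<notin> x \<and> (x \<in> F \<or> insert i x \<in> F)"
    using that assms by (auto simp: layer_def cube_def)
  ultimately show "x \<in> A_i n s F i \<longleftrightarrow> x \<in> upper n s \<union> (\<lambda>z. z - {i}) ` F"
    unfolding mem_A_i[OF assms] upper_def by blast
qed

text \<open>As all members of \<open>F\<close> have size \<open>s\<close>, the size of
  \<open>z - {i}\<close> tells whether \<open>i\<close> was deleted, so deletion is injective on
  \<open>F\<close>.\<close>

lemma card_A_i:
  assumes F: "F \<subseteq> layer {1..n} s"
  shows "card (A_i n s F i) = card (upper n s) + card F"
proof -
  have fin: "finite F" using F finite_layer[of "{1..n}" s] finite_subset by blast
  have Fp: "finite z" "card z = s" if "z \<in> F" for z using that F layerD[of "{1..n}" z s] by auto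
  have "inj_on (\<lambda>z. z - {i}) F"
  proof (rule inj_onI)
    fix x y assume xy: "x \<in> F" "y \<in> F" "x - {i} = y - {i}"
    have "i \<in> x \<longleftrightarrow> i \<in> y"
      using xy Fp card_Diff1_less[of x i] card_Diff1_less[of y i]
      by (metis Diff_empty Diff_insert0 less_irrefl)
    then show "x = y" using xy(3) by blast
  qed
  then have "card ((\<lambda>z. z - {i}) ` F) = card F" by (rule card_image)
  moreover have "upper n s \<inter> (\<lambda>z. z - {i}) ` F = {}"
  proof -
    have "card (z - {i}) \<le> s" if "z \<in> F" for z using Fp[OF that] by (metis card_Diff1_le)
    then show ?thesis by (auto simp: upper_def) (metis not_le)
  qed
  moreover have "finite (upper n s)" using cube_finite(1) by (simp add: upper_def)
  ultimately show ?thesis using fin unfolding A_i_eq[OF F] by (simp add: card_Un_disjoint)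
qed

lemma down_layer: "F \<subseteq> layer X s \<Longrightarrow> down l F \<subseteq> layer X l"
  unfolding down_def layer_def by blast

lemma down_self:
  assumes "finite X" "F \<subseteq> layer X s" shows "down s F = F"
proof
  show "down s F \<subseteq> F"
  proof
    fix x assume "x \<in> down s F"
    then obtain z where z: "card x = s" "z \<in> F" "x \<subseteq> z" by (auto simp: down_def)
    then have "card z = s" "finite z" using layerD[OF assms(1), of z s] assms(2) by auto
    then show "x \<in> F" using card_subset_eq[of z x] z by simp
  qed
  show "F \<subseteq> down s F" using assms(2) by (auto simp: down_def layer_def)
qed

lemma down_down:
  assumes "finite X" "F \<subseteq> layer X s" "l \<le> m" "m \<le> s"
  shows "down l (down m F) = down l F"
proof
  show "down l (down m F) \<subseteq> down l F" unfolding down_def by blast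
  show "down l F \<subseteq> down l (down m F)"
  proof
    fix x assume "x \<in> down l F"
    then obtain z where z: "card x = l" "z \<in> F" "x \<subseteq> z" by (auto simp: down_def)
    have "card z = s" "finite z" using layerD[OF assms(1), of z s] z(2) assms(2) by auto
    then obtain y where "x \<subseteq> y" "y \<subseteq> z" "card y = m"
      using exists_subset_between[of x m z] z assms(3,4) by auto
    then show "x \<in> down l (down m F)" using z by (auto simp: down_def)
  qed
qed

text \<open>All sets of size at least \<open>s\<close> are reached, since those other than the full
  set can be enlarged into \<open>upper n s\<close>. Lower new points come from deleting some
  \<open>j\<close> from \<open>z - {i}\<close>, and that is \<open>z - {j}\<close>, a shadow member,
  with \<open>i\<close> deleted.\<close>

lemma nb_A_i:
  assumes F: "F \<subseteq> layer {1..n} s" and s: "1 \<le> s" "s < n"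
  shows "nb {1..n} (A_i n s F i) = A_i n (s - 1) (down (s - 1) F) i"
proof (rule set_eqI)
  let ?X = "{1..n}" let ?A = "A_i n s F i" let ?D = "down (s - 1) F"
  fix x
  have D: "?D \<subseteq> layer ?X (s - 1)" using down_layer[OF F] .
  have Fp: "finite z" "card z = s" "z \<subseteq> ?X" if "z \<in> F" for z
    using that F layerD[of "{1..n}" z s] by auto
  have inD: "u \<in> ?D" if "z \<in> F" "u \<subseteq> z" "Suc (card u) = s" for u z
    using that by (auto simp: down_def)
  note mA = mem_A_i[OF F, of _ i] and mD = mem_A_i[OF D, of _ i]
  show "x \<in> nb ?X ?A \<longleftrightarrow> x \<in> A_i n (s - 1) ?D i"
  proof (cases "x \<in> cube n")
    case False
    then show ?thesis using mD by (auto simp: nb_def cube_def)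
  next
    case True
    have fx: "finite x" and xX: "x \<subseteq> ?X" using True cube_finite(2) by (auto simp: cube_def)
    have nbx: "x \<in> nb ?X ?A \<longleftrightarrow> x \<in> ?A \<or> (\<exists>j\<in>?X. flip j x \<in> ?A)" using xX by (auto simp: nb_def)
    have cfl: "card (flip j x) = (if j \<in> x then card x - 1 else Suc (card x))" for j
      using fx by (simp add: flip_def)
    have flc: "flip j x \<in> cube n" if "j \<in> ?X" for j
      using that xX by (auto simp: flip_def cube_def)
    show ?thesis
    proof
      assume "x \<in> nb ?X ?A"
      then consider "x \<in> ?A" | j where "j \<in> ?X" "flip j x \<in> ?A" using nbx by blast
      then show "x \<in> A_i n (s - 1) ?D i"
      proof cases
        case 1
        then consider "s < card x" | "x \<in> F" | "i \<notin> x" "insert i x \<in> F" using mA by blast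
        then show ?thesis
        proof cases
          case 3
          then have "Suc (card x) = s" using Fp[of "insert i x"] fx by simp
          then show ?thesis using 3 inD[of "insert i x" x] mD True by auto
        qed (use True Fp s mD in auto)
      next
        case 2
        then consider "s < card (flip j x)" | "i \<notin> flip j x" "flip j x \<in> F"
          | "i \<notin> flip j x" "insert i (flip j x) \<in> F" using mA by blast
        then show ?thesis
        proof cases
          case 1
          then have "s - 1 < card x" using cfl[of j] s by (auto split: if_splits)
          then show ?thesis using mD True by auto
        next
          case 2
          then have c: "card (flip j x) = s" using Fp by auto
          show ?thesis
          proof (cases "j \<in> x")
            case True
            then have "s - 1 < card x" using cfl[of j] c s by auto
            then show ?thesis using mD \<open>x \<in> cube n\<close> by auto
          next
            case False
            then have "x \<in> ?D" using inD[OF 2(2), of x] c cfl[of j] by (auto simp: flip_def)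
            moreover have "i \<notin> x" using 2(1) False by (auto simp: flip_def)
            ultimately show ?thesis using mD \<open>x \<in> cube n\<close> by auto
          qed
        next
          case 3
          have "finite (flip j x)" using fx by (simp add: flip_def)
          then have c: "Suc (card (flip j x)) = s" using Fp[OF 3(2)] 3(1) by simp
          show ?thesis
          proof (cases "j \<in> x")
            case True
            then have "card x > 0" using fx card_gt_0_iff by blast
            then have "s - 1 < card x" using cfl[of j] c s True by auto
            then show ?thesis using mD \<open>x \<in> cube n\<close> by auto
          next
            case False
            then have ix: "i \<notin> x" using 3(1) by (auto simp: flip_def)
            have "insert i x \<in> ?D"
              using inD[OF 3(2), of "insert i x"] c cfl[of j] False fx ix by (auto simp: flip_def)
            then show ?thesis using mD \<open>x \<in> cube n\<close> ix by auto
          qed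
        qed
      qed
    next
      assume "x \<in> A_i n (s - 1) ?D i"
      then consider "s - 1 < card x" | "i \<notin> x" "x \<in> ?D" | "i \<notin> x" "insert i x \<in> ?D"
        using mD by blast
      then show "x \<in> nb ?X ?A"
      proof cases
        case 1
        show ?thesis
        proof (cases "x = ?X")
          case True
          then have "x \<in> ?A" using mA \<open>x \<in> cube n\<close> s by auto
          then show ?thesis using nbx by blast
        next
          case False
          then obtain j where j: "j \<in> ?X" "j \<notin> x" using xX by blast
          then have "s < card (flip j x)" using 1 cfl[of j] by auto
          then have "flip j x \<in> ?A" using mA flc[OF j(1)] by blast
          then show ?thesis using nbx j by blast
        qed
      next
        case 2
        then obtain z where z: "z \<in> F" "x \<subseteq> z" "card x = s - 1" by (auto simp: down_def)
        have "card (z - x) = 1" using z Fp[OF z(1)] s fx by (simp add: card_Diff_subset)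
        then obtain j where "z - x = {j}" using card_1_singletonE by blast
        then have j: "j \<notin> x" "z = insert j x" using z(2) by auto
        show ?thesis
        proof (cases "j = i")
          case True
          then show ?thesis using nbx mA \<open>x \<in> cube n\<close> j z(1) by auto
        next
          case False
          have jX: "j \<in> ?X" using j Fp[OF z(1)] by auto
          have "flip j x \<in> ?A" using mA flc[OF jX] j z(1) False 2(1) by (simp add: flip_def)
          then show ?thesis using nbx jX by blast
        qed
      next
        case 3
        then obtain z where z: "z \<in> F" "insert i x \<subseteq> z" "card (insert i x) = s - 1"
          by (auto simp: down_def)
        have "card (z - insert i x) = 1"
          using z Fp[OF z(1)] s fx by (subst card_Diff_subset) auto
        then obtain j where "z - insert i x = {j}" using card_1_singletonE by blast
        then have j: "j \<notin> x" "j \<noteq> i" "z = insert i (insert j x)" using z(2) by auto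
        have jX: "j \<in> ?X" using j Fp[OF z(1)] by auto
        have "flip j x \<in> ?A" using mA flc[OF jX] j z(1) 3(1) by (simp add: flip_def)
        then show ?thesis using nbx jX by blast
      qed
    qed
  qed
qed

lemma nbhd_A_i:
  assumes F: "F \<subseteq> layer {1..n} s" and "s < n" "t \<le> s"
  shows "nbhd n t (A_i n s F i) = A_i n (s - t) (down (s - t) F) i"
  using assms(3)
proof (induction t)
  case 0
  then show ?case using nbhd_0[OF A_i_subset] down_self[OF _ F] by simp
next
  case (Suc t)
  then have "nbhd n (Suc t) (A_i n s F i) = nb {1..n} (A_i n (s - t) (down (s - t) F) i)"
    using nbhd_Suc[OF A_i_subset] by simp
  also have "\<dots> = A_i n (s - t - 1) (down (s - t - 1) (down (s - t) F)) i"
    using Suc.prems assms(2) by (intro nb_A_i down_layer[OF F]) auto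
  also have "down (s - t - 1) (down (s - t) F) = down (s - Suc t) F"
    using Suc.prems by (subst down_down[OF _ F]) auto
  finally show ?case by simp
qed

text \<open>The right-hand side does not mention \<open>i\<close>: all candidates built from one
  family have neighbourhoods of equal size.\<close>

lemma card_nbhd_A_i:
  assumes "F \<subseteq> layer {1..n} s" "s < n" "t \<le> s"
  shows "card (nbhd n t (A_i n s F i)) = card (upper n (s - t)) + card (down (s - t) F)"
  unfolding nbhd_A_i[OF assms] by (rule card_A_i[OF down_layer[OF assms(1)]])

text \<open>The automorphism complements every coordinate except \<open>i\<close>. Sets containing
  \<open>i\<close> are governed by size alone on both sides, and size at most \<open>s\<close> turns
  into size above \<open>n - s\<close>. Sets avoiding \<open>i\<close> are sent to the complement of
  \<open>insert i x\<close>, where non-membership in \<open>F\<close> becomes membership in the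
  dual. For \<open>i = 0\<close> this is plain complementation.\<close>

lemma compl_A_i_iso:
  assumes F: "F \<subseteq> layer {1..n} s" and "s \<le> n"
  shows "cube_iso n (cube n - A_i n s F i) (A_i n (n - s) (dual {1..n} s F) i)"
proof -
  let ?X = "{1..n}" let ?D = "dual ?X s F" let ?f = "cmap id (?X - {i})"
  have D: "?D \<subseteq> layer ?X (n - s)" using dual_layer[of ?X s F] by simp
  have Fp: "finite z" "card z = s" "z \<subseteq> ?X" if "z \<in> F" for z
    using that F layerD[of "{1..n}" z s] by auto
  have bij: "bij_betw ?f (cube n) (cube n)" by (rule cmap_bij) auto
  have iff: "x \<notin> A_i n s F i \<longleftrightarrow> ?f x \<in> A_i n (n - s) ?D i" if x: "x \<in> cube n" for x
  proof -
    have fx: "finite x" and xX: "x \<subseteq> ?X" using x cube_finite(2) by (auto simp: cube_def)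
    have fc: "?f x \<in> cube n" using bij_betwE[OF bij] x by blast
    have cX: "card (?X - x) = n - card x" "card x \<le> n"
      using fx xX card_Diff_subset[of x ?X] card_mono[of ?X x] by auto
    have Diff2: "?X - (?X - x) = x" using xX by auto
    show ?thesis
    proof (cases "i \<in> x")
      case True
      then have f: "?f x = insert i (?X - x)" using xX by (auto simp: cmap_def)
      have "card (?f x) = Suc (n - card x)" unfolding f using cX True by simp
      moreover have "i \<in> ?f x" using f by simp
      ultimately show ?thesis
        unfolding mem_A_i[OF F] mem_A_i[OF D] using True x fc cX assms(2) by auto
    next
      case False
      have f: "?f x = ?X - insert i x" using False xX by (auto simp: cmap_def)
      have if': "i \<notin> ?f x" using f by simp
      have d1: "?f x \<in> ?D \<longleftrightarrow> (card (?X \<inter> insert i x) = s \<and> ?X \<inter> insert i x \<notin> F)"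
      proof -
        have "?X - ?f x = ?X \<inter> insert i x" unfolding f by auto
        then show ?thesis unfolding dual_def layer_def using f by auto
      qed
      have d2: "insert i (?f x) \<in> ?D \<longleftrightarrow> i \<in> ?X \<and> card x = s \<and> x \<notin> F"
      proof (cases "i \<in> ?X")
        case True
        then have "insert i (?f x) = ?X - x" unfolding f using False by blast
        then show ?thesis unfolding dual_def layer_def using True Diff2 xX by auto
      next
        case False
        then show ?thesis by (auto simp: dual_def)
      qed
      show ?thesis
      proof (cases "i \<in> ?X")
        case True
        have X': "?X \<inter> insert i x = insert i x" using True xX by auto
        have ci: "card (insert i x) = Suc (card x)" using False fx by simp
        have "insert i x \<subseteq> ?X" using True xX by auto
        then have le: "Suc (card x) \<le> n" using card_mono[of ?X "insert i x"] ci by simp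
        have cf: "card (?f x) = n - Suc (card x)"
          unfolding f using card_Diff_subset[of "insert i x" ?X] fx ci \<open>insert i x \<subseteq> ?X\<close> by simp
        have "x \<in> F \<Longrightarrow> card x = s" "insert i x \<in> F \<Longrightarrow> Suc (card x) = s" using Fp ci by auto
        then show ?thesis
          unfolding mem_A_i[OF F] mem_A_i[OF D] d1 d2 cf X' ci
          using True False x fc if' le assms(2) by auto
      next
        case iX: False
        have X': "?X \<inter> insert i x = x" "?X - insert i x = ?X - x" using iX xX by auto
        have cf: "card (?f x) = n - card x" unfolding f X' using cX by simp
        have "x \<in> F \<Longrightarrow> card x = s" "insert i x \<notin> F" using Fp(2) Fp(3)[of "insert i x"] iX by blast+
        then show ?thesis
          unfolding mem_A_i[OF F] mem_A_i[OF D] d1 d2 cf X'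
          using iX False x fc if' cX assms(2) by auto
      qed
    qed
  qed
  have "?f ` (cube n - A_i n s F i) = A_i n (n - s) ?D i"
  proof (intro set_eqI iffI)
    fix y assume "y \<in> ?f ` (cube n - A_i n s F i)"
    then show "y \<in> A_i n (n - s) ?D i" using iff by auto
  next
    fix y assume y: "y \<in> A_i n (n - s) ?D i"
    then have "y \<in> cube n" using A_i_subset by blast
    then obtain x where "x \<in> cube n" "y = ?f x" using bij by (auto simp: bij_betw_def)
    then show "y \<in> ?f ` (cube n - A_i n s F i)" using iff y by auto
  qed
  then show ?thesis unfolding cube_iso_iff by (intro exI[of _ id] exI[of _ "?X - {i}"]) auto
qed

section \<open>Uniqueness of families with minimal iterated shadows\<close>

abbreviation colex_initial :: "nat \<Rightarrow> nat \<Rightarrow> nat set set \<Rightarrow> bool" where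
  "colex_initial n s G \<equiv> initial (\<lambda>x. int (set_encode x)) (layer {1..n} s) G"

lemma card_layer: "finite X \<Longrightarrow> card (layer X s) = card X choose s"
  unfolding layer_def by (rule n_subsets)

lemma inj_on_encode_layer: "inj_on (\<lambda>x. int (set_encode x)) (layer {1..n} s)"
proof (rule inj_onI)
  fix x y assume "x \<in> layer {1..n} s" "y \<in> layer {1..n} s" "int (set_encode x) = int (set_encode y)"
  then show "x = y" using layerD[of "{1..n}"] set_encode_eq[of x y] by simp
qed

lemma card_dual:
  assumes "finite X" "F \<subseteq> layer X s"
  shows "card (dual X s F) = (card X choose s) - card F"
proof -
  have "dual X s F = (\<lambda>z. X - z) ` (layer X s - F)"
  proof (rule set_eqI)
    fix z
    have "X - (X - z) = z" if "z \<subseteq> X" using that by blast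
    then show "z \<in> dual X s F \<longleftrightarrow> z \<in> (\<lambda>z. X - z) ` (layer X s - F)"
      unfolding dual_def by (auto simp: layer_def double_diff)
  qed
  moreover have "inj_on (\<lambda>z. X - z) (layer X s - F)"
    by (rule inj_onI) (auto simp: layer_def)
  moreover have "finite F" using assms finite_layer finite_subset by blast
  ultimately show ?thesis
    using card_layer[OF assms(1), of s] assms(2) by (simp add: card_image card_Diff_subset)
qed

lemma dual_image:
  assumes \<sigma>: "bij_betw \<sigma> X Y" and F: "F \<subseteq> layer X s"
  shows "dual Y s ((`) \<sigma> ` F) = (`) \<sigma> ` dual X s F"
proof -
  have inj: "inj_on \<sigma> X" and Y: "Y = \<sigma> ` X" using \<sigma> by (auto simp: bij_betw_def)
  have compl: "\<sigma> ` X - \<sigma> ` z = \<sigma> ` (X - z)" if "z \<subseteq> X" for z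
    using inj_on_image_set_diff[OF inj, of X z] that by simp
  have cardim: "card (\<sigma> ` z) = card z" if "z \<subseteq> X" for z
    using that inj by (meson card_image inj_on_subset)
  have memF: "\<sigma> ` z \<in> (`) \<sigma> ` F \<longleftrightarrow> z \<in> F" if "z \<subseteq> X" for z
    using inj_on_image_eq_iff[OF inj that] F by (auto simp: layer_def)
  have key: "\<sigma> ` z \<in> dual Y s ((`) \<sigma> ` F) \<longleftrightarrow> z \<in> dual X s F" if z: "z \<subseteq> X" for z
    unfolding dual_def layer_def Y mem_Collect_eq Diff_iff compl[OF z]
    using memF[of "X - z"] cardim[of "X - z"] z by auto
  show ?thesis
  proof (intro set_eqI iffI)
    fix w assume w: "w \<in> dual Y s ((`) \<sigma> ` F)"
    then have "w \<subseteq> \<sigma> ` X" by (simp add: dual_def Y)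
    then obtain z where "z \<subseteq> X" "w = \<sigma> ` z" by (meson subset_imageE)
    then show "w \<in> (`) \<sigma> ` dual X s F" using key w by blast
  next
    fix w assume "w \<in> (`) \<sigma> ` dual X s F"
    then obtain z where z: "z \<in> dual X s F" "w = \<sigma> ` z" by blast
    then have "z \<subseteq> X" by (simp add: dual_def)
    then show "w \<in> dual Y s ((`) \<sigma> ` F)" using key z by blast
  qed
qed

text \<open>Encodings of complementary sets add up to a constant, so complementation reverses the
  order; passing to the non-members reverses it once more.\<close>

lemma colex_initial_dual:
  assumes G: "colex_initial n s G" and "s \<le> n"
  shows "colex_initial n (n - s) (dual {1..n} s G)"
  unfolding initial_def
proof (intro conjI ballI impI)
  let ?X = "{1..n}"
  show "dual ?X s G \<subseteq> layer ?X (n - s)" using dual_layer[of ?X s G] by simp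
  fix y x assume y: "y \<in> dual ?X s G" and x: "x \<in> layer ?X (n - s)"
    and less: "int (set_encode x) < int (set_encode y)"
  have yX: "y \<subseteq> ?X" "?X - y \<in> layer ?X s" "?X - y \<notin> G" using y by (auto simp: dual_def)
  have xX: "x \<subseteq> ?X" "card x = n - s" "finite x" using x layerD[of ?X] by auto
  have "card (?X - x) = s" using card_Diff_subset[OF xX(3,1)] xX(2) assms(2) by simp
  then have xl: "?X - x \<in> layer ?X s" by (simp add: layer_def)
  have "set_encode (?X - z) + set_encode z = set_encode ?X" if "z \<subseteq> ?X" for z
    using that finite_subset[OF that] by (subst set_encode_Un[symmetric]) (auto simp: Un_absorb2)
  from this[OF xX(1)] this[OF yX(1)] have "set_encode (?X - y) < set_encode (?X - x)"
    using less by linarith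
  then have "?X - x \<notin> G" using initialD[OF G _ yX(2)] yX(3) by auto
  then show "x \<in> dual ?X s G" using xX(1) xl by (simp add: dual_def)
qed

lemma colex_initial_restrict:
  assumes "colex_initial (Suc m) s G" "G \<subseteq> layer {1..m} s"
  shows "colex_initial m s G"
proof -
  have "layer {1..m} s \<subseteq> layer {1..Suc m} s" by (auto simp: layer_def)
  then show ?thesis using assms unfolding initial_def by blast
qed

lemma layer_restrict_less:
  assumes "x \<in> layer {1..m} s" "y \<in> layer {1..Suc m} s" "y \<notin> layer {1..m} s"
  shows "set_encode x < set_encode y"
proof (rule set_encode_lessI[of _ _ "Suc m"])
  have x: "x \<subseteq> {1..m}" "finite x" and y: "y \<subseteq> {1..Suc m}" "finite y"
    using assms layerD[of "{1..m}" x] layerD[of "{1..Suc m}" y] by auto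
  then show "finite x" "finite y" "Suc m \<notin> x" by auto
  have "\<not> y \<subseteq> {1..m}" using assms by (auto simp: layer_def)
  then obtain i where "i \<in> y" "i \<notin> {1..m}" by blast
  then show "Suc m \<in> y" using y(1) by (metis atLeastAtMost_iff le_Suc_eq subsetD)
  show "i \<in> x \<longleftrightarrow> i \<in> y" if "i > Suc m" for i using that x(1) y(1) by fastforce
qed

text \<open>A member containing \<open>Suc m\<close> comes after every \<open>s\<close>-subset of
  \<open>{1..m}\<close>, so all of these lie in \<open>G\<close>. A dual set containing
  \<open>Suc m\<close> would be the complement of one of them.\<close>

lemma colex_initial_cases:
  assumes G: "colex_initial (Suc m) s G"
  shows "G \<subseteq> layer {1..m} s \<or> dual {1..Suc m} s G \<subseteq> layer {1..m} (Suc m - s)"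
proof (cases "G \<subseteq> layer {1..m} s")
  case False
  then obtain y where y: "y \<in> G" "y \<notin> layer {1..m} s" by blast
  then have yl: "y \<in> layer {1..Suc m} s" using initial_subset[OF G] by blast
  have all: "x \<in> G" if "x \<in> layer {1..m} s" for x
  proof (rule initialD[OF G y(1)])
    show "x \<in> layer {1..Suc m} s" using that by (auto simp: layer_def)
    show "int (set_encode x) < int (set_encode y)" using layer_restrict_less[OF that yl y(2)] by simp
  qed
  have "dual {1..Suc m} s G \<subseteq> layer {1..m} (Suc m - s)"
  proof
    fix z assume z: "z \<in> dual {1..Suc m} s G"
    have "Suc m \<notin> z"
    proof
      assume "Suc m \<in> z"
      then have "{1..Suc m} - z \<subseteq> {1..m}"
        by (metis DiffD1 DiffD2 atLeastAtMost_iff le_Suc_eq subsetI)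
      then have "{1..Suc m} - z \<in> layer {1..m} s" using z by (simp add: dual_def layer_def)
      then show False using all z by (simp add: dual_def)
    qed
    moreover have "z \<in> layer {1..Suc m} (Suc m - s)" using dual_layer[of "{1..Suc m}" s G] z by auto
    ultimately show "z \<in> layer {1..m} (Suc m - s)"
      unfolding layer_def by (simp, metis atLeastAtMost_iff le_Suc_eq subset_iff)
  qed
  then show ?thesis by blast
qed simp

text \<open>A set of size \<open>card X - s\<close> that avoids \<open>j\<close> is always in the
  dual, because its complement contains \<open>j\<close> and no member of \<open>F\<close> does.
  These sets cover the whole layer over \<open>X - {j}\<close>; shadow sets containing
  \<open>j\<close> come from the dual over \<open>X - {j}\<close>.\<close>

lemma down_dual_restrict:
  assumes X: "finite X" "j \<in> X" and F: "F \<subseteq> layer (X - {j}) s" and s: "1 \<le> s" "Suc l + s \<le> card X"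
  shows "down (Suc l) (dual X s F)
    = layer (X - {j}) (Suc l) \<union> insert j ` down l (dual (X - {j}) s F)"
proof (intro set_eqI iffI)
  fix x assume "x \<in> down (Suc l) (dual X s F)"
  then obtain z where x: "card x = Suc l" "x \<subseteq> z" and z: "z \<subseteq> X" "card (X - z) = s" "X - z \<notin> F"
    by (auto simp: down_def dual_def layer_def)
  show "x \<in> layer (X - {j}) (Suc l) \<union> insert j ` down l (dual (X - {j}) s F)"
  proof (cases "j \<in> x")
    case False
    then show ?thesis using x z by (auto simp: layer_def)
  next
    case True
    have fx: "finite x" using x z X finite_subset by (meson order_trans)
    have "(X - {j}) - (z - {j}) = X - z" using True x by auto
    then have "z - {j} \<in> dual (X - {j}) s F" using z by (auto simp: dual_def layer_def)
    moreover have "card (x - {j}) = l" using fx True x by simp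
    ultimately have "x - {j} \<in> down l (dual (X - {j}) s F)" using x unfolding down_def by blast
    moreover have "x = insert j (x - {j})" using True by auto
    ultimately show ?thesis by blast
  qed
next
  fix x assume "x \<in> layer (X - {j}) (Suc l) \<union> insert j ` down l (dual (X - {j}) s F)"
  then consider "x \<in> layer (X - {j}) (Suc l)" |
    y where "x = insert j y" "y \<in> down l (dual (X - {j}) s F)" by blast
  then show "x \<in> down (Suc l) (dual X s F)"
  proof cases
    case 1
    then have x: "x \<subseteq> X - {j}" "card x = Suc l" by (auto simp: layer_def)
    \<comment> \<open>The second bound uses \<open>1 \<le> s\<close>: it leaves room for a superset
      of size \<open>card X - s\<close> that avoids \<open>j\<close>.\<close>
    have "card x \<le> card X - s" "card X - s \<le> card (X - {j})" using x s X by auto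
    then obtain z where z: "x \<subseteq> z" "z \<subseteq> X - {j}" "card z = card X - s"
      using exists_subset_between[of x "card X - s" "X - {j}"] x X by auto
    have "finite z" using z X finite_subset[of z "X - {j}"] by auto
    then have "card (X - z) = s" using z s card_Diff_subset[of z X] by auto
    moreover have "j \<in> X - z" "\<And>w. w \<in> F \<Longrightarrow> j \<notin> w" using z(2) X(2) F unfolding layer_def by blast+
    then have "X - z \<notin> F" by blast
    ultimately have "z \<in> dual X s F" using z by (auto simp: dual_def layer_def)
    then show ?thesis using x z unfolding down_def by blast
  next
    case 2
    then obtain z where y: "card y = l" "y \<subseteq> z"
      and z: "z \<subseteq> X - {j}" "card (X - {j} - z) = s" "X - {j} - z \<notin> F"
      by (auto simp: down_def dual_def layer_def)
    have "X - insert j z = X - {j} - z" by auto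
    then have "insert j z \<in> dual X s F" using z X by (auto simp: dual_def layer_def)
    moreover have "finite y" "j \<notin> y" using y z X finite_subset[of y "X - {j}"] by auto
    then have "card x = Suc l" using 2(1) y by simp
    ultimately show ?thesis using 2(1) y unfolding down_def by blast
  qed
qed

lemma card_down_dual_restrict:
  assumes X: "finite X" "j \<in> X" and F: "F \<subseteq> layer (X - {j}) s" and s: "1 \<le> s" "Suc l + s \<le> card X"
  shows "card (down (Suc l) (dual X s F))
    = (card X - 1 choose Suc l) + card (down l (dual (X - {j}) s F))"
proof -
  have fin: "finite (X - {j})" using X by simp
  have D: "down l (dual (X - {j}) s F) \<subseteq> layer (X - {j}) l" using down_layer[OF dual_layer[OF fin]] .
  have "card (layer (X - {j}) (Suc l) \<union> insert j ` down l (dual (X - {j}) s F))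
    = card (layer (X - {j}) (Suc l)) + card (down l (dual (X - {j}) s F))"
    using D finite_subset[OF D] finite_layer[OF fin]
    by (intro card_join) (auto simp: layer_def)
  then show ?thesis
    unfolding down_dual_restrict[OF assms] card_layer[OF fin] using X by simp
qed

lemma down_empty_above:
  assumes "finite X" "F \<subseteq> layer X s" "s < l" shows "down l F = {}"
proof -
  have "card x \<le> s" if "z \<in> F" "x \<subseteq> z" for x z
    using that layerD[OF assms(1), of z s] assms(2) card_mono[of z x] by auto
  then have "\<not> (\<exists>z\<in>F. x \<subseteq> z)" if "card x = l" for x using that assms(3) not_less by blast
  then show ?thesis unfolding down_def by blast
qed

text \<open>The ground set \<open>X\<close> is arbitrary because the induction deletes an uncovered
  point of \<open>X\<close>, whichever it is, against the last point of \<open>{1..n}\<close>.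
  Carrying both shadow conditions makes the hypotheses symmetric under duality.\<close>

lemma family_unique:
  assumes "finite X" "card X = n" "s \<le> n" "F \<subseteq> layer X s" "colex_initial n s G" "card F = card G"
    and "\<And>l. card (down l F) \<le> card (down l G)"
    and "\<And>l. card (down l (dual X s F)) \<le> card (down l (dual {1..n} s G))"
  shows "\<exists>\<sigma>. bij_betw \<sigma> X {1..n} \<and> (`) \<sigma> ` F = G"
  using assms
proof (induction n arbitrary: X s F G)
  case 0
  then have "X = {}" by simp
  then have sub: "F \<subseteq> {{}}" "G \<subseteq> {{}}"
    using 0 initial_subset[OF 0(5)] by (auto simp: layer_def)
  then have "F = G" using 0(6) by (auto simp: subset_singleton_iff)
  moreover have "(`) \<sigma> ` F = F" for \<sigma> :: "nat \<Rightarrow> nat" using sub(1) by (auto simp: subset_singleton_iff)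
  ultimately show ?case using \<open>X = {}\<close> by auto
next
  case (Suc m)
  have finX: "finite X" and cX: "card X = Suc m" using Suc.prems by auto
  obtain \<tau> where \<tau>: "bij_betw \<tau> X {1..Suc m}"
    using finX cX by (metis card_atLeastAtMost diff_Suc_1 finite_atLeastAtMost finite_same_card_bij)
  \<comment> \<open>The case in which \<open>G\<close> avoids the last point, stated for arbitrary
    families so that it also applies to the duals.\<close>
  have step: "\<exists>\<sigma>. bij_betw \<sigma> X {1..Suc m} \<and> (`) \<sigma> ` F = G"
    if F: "F \<subseteq> layer X s" and G: "colex_initial (Suc m) s G" and cFG: "card F = card G"
      and dn: "\<And>l. card (down l F) \<le> card (down l G)"
      and dd: "\<And>l. card (down l (dual X s F)) \<le> card (down l (dual {1..Suc m} s G))"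
      and Gm: "G \<subseteq> layer {1..m} s" for s F G
  proof -
    have finFG: "finite F" "finite G"
      using finite_subset[OF F] finite_layer[OF finX] finite_subset[OF Gm] finite_layer[of "{1..m}"] by auto
    consider "F = {}" | "s = 0" "F \<noteq> {}" | "1 \<le> s" "F \<noteq> {}" by linarith
    then show ?thesis
    proof cases
      case 1
      then have "G = {}" using cFG finFG by simp
      then show ?thesis using 1 \<tau> by auto
    next
      case 2
      then have "layer X s = {{}}" "layer {1..m} s = {{}}"
        using finX by (auto simp: layer_def dest: finite_subset)
      then have "F = {{}}" "G \<subseteq> {{}}" using 2 F Gm by auto
      then have "F = {{}}" "G = {{}}" using cFG by (auto simp: subset_singleton_iff)
      then show ?thesis using \<tau> by auto
    next
      case 3
      \<comment> \<open>The shadow on level one counts covered points, and \<open>G\<close> covers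
        at most \<open>m\<close> of them.\<close>
      have "\<exists>j\<in>X. {j} \<notin> down 1 F"
      proof (rule ccontr)
        assume "\<not> ?thesis"
        then have "layer X 1 \<subseteq> down 1 F" by (auto simp: layer_def card_1_singleton_iff)
        moreover have "finite (down 1 F)"
          using finite_subset[OF down_layer[OF F]] finite_layer[OF finX] by blast
        ultimately have "Suc m \<le> card (down 1 F)"
          using card_mono[of "down 1 F" "layer X 1"] card_layer[OF finX, of 1] cX by simp
        also have "\<dots> \<le> card (down 1 G)" by (rule dn)
        also have "\<dots> \<le> card (layer {1..m} 1)"
          using down_layer[OF Gm, of 1] finite_layer[of "{1..m}" 1] by (intro card_mono) auto
        also have "\<dots> = m" using card_layer[of "{1..m}" 1] by simp
        finally show False by simp
      qed
      then obtain j where j: "j \<in> X" "{j} \<notin> down 1 F" by blast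
      have "j \<notin> z" if "z \<in> F" for z using that j(2) by (auto simp: down_def)
      then have Fj: "F \<subseteq> layer (X - {j}) s" using F by (auto simp: layer_def)
      have finXj: "finite (X - {j})" and cXj: "card (X - {j}) = m" using finX j cX by auto
      obtain z where z: "z \<in> F" using 3 by blast
      then have "z \<subseteq> X - {j}" "card z = s" using Fj by (auto simp: layer_def)
      then have sm: "s \<le> m" using card_mono[OF finXj, of z] cXj by simp
      have XS: "{1..Suc m} - {Suc m} = {1..m}" by auto
      \<comment> \<open>The same full layer of \<open>m choose Suc l\<close> sets splits off from
        both dual shadows.\<close>
      have "card (down l (dual (X - {j}) s F)) \<le> card (down l (dual {1..m} s G))" for l
      proof (cases "l + s \<le> m")
        case True
        have "(m choose Suc l) + card (down l (dual (X - {j}) s F)) = card (down (Suc l) (dual X s F))"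
          using card_down_dual_restrict[OF finX j(1) Fj 3(1), of l] True cX by simp
        also have "\<dots> \<le> card (down (Suc l) (dual {1..Suc m} s G))" by (rule dd)
        also have "\<dots> = (m choose Suc l) + card (down l (dual {1..m} s G))"
          using card_down_dual_restrict[of "{1..Suc m}" "Suc m" G s l] XS Gm 3(1) True by simp
        finally show ?thesis by simp
      next
        case False
        have "card (X - {j}) - s < l" using False sm cXj by simp
        then have "down l (dual (X - {j}) s F) = {}"
          by (rule down_empty_above[OF finXj dual_layer[OF finXj]])
        then show ?thesis by simp
      qed
      then obtain \<sigma> where \<sigma>: "bij_betw \<sigma> (X - {j}) {1..m}" "(`) \<sigma> ` F = G"
        using Suc.IH[OF finXj cXj sm Fj colex_initial_restrict[OF G Gm] cFG dn] by blast
      let ?s = "\<sigma>(j := Suc m)"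
      have "bij_betw ?s (X - {j}) {1..m}" using \<sigma>(1) by (rule bij_betw_cong[THEN iffD1, rotated]) auto
      then have "bij_betw ?s ((X - {j}) \<union> {j}) ({1..m} \<union> {?s j})"
        by (intro notIn_Un_bij_betw) auto
      moreover have "(X - {j}) \<union> {j} = X" using j by auto
      moreover have "{1..m} \<union> {?s j} = {1..Suc m}" by auto
      ultimately have bij: "bij_betw ?s X {1..Suc m}" by simp
      have "?s ` z = \<sigma> ` z" if "z \<in> F" for z
      proof (rule image_cong[OF refl])
        fix a assume "a \<in> z"
        then have "a \<noteq> j" using that Fj unfolding layer_def by blast
        then show "?s a = \<sigma> a" by simp
      qed
      then have "(`) ?s ` F = (`) \<sigma> ` F" by (rule image_cong[OF refl])
      then have "(`) ?s ` F = G" using \<sigma>(2) by simp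
      then show ?thesis using bij by blast
    qed
  qed
  show ?case
  proof (cases "G \<subseteq> layer {1..Suc m - 1} s")
    case True
    then show ?thesis using step[OF Suc.prems(4-8)] by simp
  next
    \<comment> \<open>The duals satisfy the hypotheses with the two shadow conditions exchanged, and
      now the dual of \<open>G\<close> avoids the last point. Dualising again carries the
      permutation back to \<open>F\<close>.\<close>
    case False
    let ?Y = "{1..Suc m}"
    have cY: "card ?Y = Suc m" by simp
    have GY: "G \<subseteq> layer ?Y s" using initial_subset[OF Suc.prems(5)] .
    have Gd: "dual ?Y s G \<subseteq> layer {1..m} (Suc m - s)"
      using colex_initial_cases[OF Suc.prems(5)] False by simp
    have ddF: "dual X (Suc m - s) (dual X s F) = F"
      using dual_dual[OF finX Suc.prems(4)] Suc.prems(3) cX by simp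
    have ddG: "dual ?Y (Suc m - s) (dual ?Y s G) = G"
      using dual_dual[OF _ GY] Suc.prems(3) by simp
    have dF: "dual X s F \<subseteq> layer X (Suc m - s)" using dual_layer[OF finX, of s F] cX by simp
    have "card (dual X s F) = card (dual ?Y s G)"
      using card_dual[OF finX Suc.prems(4)] card_dual[OF _ GY] cX Suc.prems(6) by simp
    then obtain \<sigma> where \<sigma>: "bij_betw \<sigma> X ?Y" "(`) \<sigma> ` dual X s F = dual ?Y s G"
      using step[OF dF colex_initial_dual[OF Suc.prems(5,3)] _ Suc.prems(8) _ Gd]
        Suc.prems(7) ddF ddG by auto
    have "G = dual ?Y (Suc m - s) ((`) \<sigma> ` dual X s F)" using ddG \<sigma>(2) by simp
    also have "\<dots> = (`) \<sigma> ` dual X (Suc m - s) (dual X s F)" using dual_image[OF \<sigma>(1) dF] .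
    finally show ?thesis using \<sigma>(1) ddF by auto
  qed
qed

section \<open>Colexicographic segments and extremality\<close>

text \<open>The predecessors of a member of an initial segment form a proper subset of it, whereas a
  non-member is preceded by the whole segment; so counting predecessors singles out the segment of
  size \<open>k\<close>.\<close>

lemma colex_seg_initial:
  assumes "k \<le> n choose s"
  shows "colex_initial n s (colex_seg n s k)" "card (colex_seg n s k) = k"
proof -
  let ?L = "layer {1..n} s" let ?e = "\<lambda>x. int (set_encode x)"
  have fin: "finite ?L" using finite_layer[of "{1..n}" s] by simp
  obtain I where I: "initial ?e ?L I" "card I = k"
    using initial_exists[OF fin inj_on_encode_layer] assms card_layer[of "{1..n}" s] by auto
  have IL: "I \<subseteq> ?L" using initial_subset[OF I(1)] .
  have finI: "finite I" using IL fin finite_subset by blast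
  have pre: "{C \<in> ?L. colex_less C B} = {C \<in> ?L. set_encode C < set_encode B}" if "B \<in> ?L" for B
  proof -
    have "finite C" if "C \<in> ?L" for C using that layerD[of "{1..n}" C s] by simp
    then show ?thesis using that by (auto simp: colex_less_iff)
  qed
  have "B \<in> I \<longleftrightarrow> card {C \<in> ?L. set_encode C < set_encode B} < k" if B: "B \<in> ?L" for B
  proof
    assume BI: "B \<in> I"
    have "{C \<in> ?L. set_encode C < set_encode B} \<subset> I"
      using initialD[OF I(1) BI] BI by auto
    then show "card {C \<in> ?L. set_encode C < set_encode B} < k"
      using psubset_card_mono[OF finI] I(2) by blast
  next
    assume less: "card {C \<in> ?L. set_encode C < set_encode B} < k"
    show "B \<in> I"
    proof (rule ccontr)
      assume BI: "B \<notin> I"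
      have "I \<subseteq> {C \<in> ?L. set_encode C < set_encode B}"
      proof
        fix C assume C: "C \<in> I"
        then have "\<not> set_encode B < set_encode C" using initialD[OF I(1) C B] BI by auto
        moreover have "set_encode B \<noteq> set_encode C"
          using inj_onD[OF inj_on_encode_layer _ B, of C] C IL BI by auto
        ultimately show "C \<in> {C \<in> ?L. set_encode C < set_encode B}" using C IL by auto
      qed
      then have "k \<le> card {C \<in> ?L. set_encode C < set_encode B}"
        using card_mono[of "{C \<in> ?L. set_encode C < set_encode B}" I] fin I(2) by simp
      then show False using less by simp
    qed
  qed
  then have "colex_seg n s k = I" using IL pre by (auto simp: colex_seg_def)
  then show "colex_initial n s (colex_seg n s k)" "card (colex_seg n s k) = k" using I by auto
qed

text \<open>Sets avoiding the last point come first, so \<open>layer {1..m} s\<close> is itself an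
  initial segment. The upper bound on the size of \<open>A\<close> enters the proof through this
  fact.\<close>

lemma colex_seg_restrict:
  assumes "k \<le> m choose s"
  shows "colex_seg (Suc m) s k \<subseteq> layer {1..m} s"
proof (rule initial_card_subset)
  have k: "k \<le> Suc m choose s" using assms by (cases s) (simp_all add: trans_le_add2)
  show "colex_initial (Suc m) s (colex_seg (Suc m) s k)" using colex_seg_initial(1)[OF k] .
  show "colex_initial (Suc m) s (layer {1..m} s)"
    unfolding initial_def
  proof (intro conjI ballI impI)
    show "layer {1..m} s \<subseteq> layer {1..Suc m} s" by (auto simp: layer_def)
    fix y x assume "y \<in> layer {1..m} s" "x \<in> layer {1..Suc m} s" "int (set_encode x) < int (set_encode y)"
    then show "x \<in> layer {1..m} s" using layer_restrict_less[of y m s x] by auto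
  qed
  show "card (colex_seg (Suc m) s k) \<le> card (layer {1..m} s)"
    using colex_seg_initial(2)[OF k] card_layer[of "{1..m}" s] assms by simp
qed (use inj_on_encode_layer finite_layer[of "{1..Suc m}" s] in auto)

lemma card_upper:
  assumes "n \<ge> 1" "r \<le> n - 1"
  shows "card (upper n (n - r - 1)) = f_r n r"
proof -
  let ?X = "{1..n}"
  have cc: "card (?X - x) = n - card x" "card x \<le> n" if "x \<subseteq> ?X" for x
    using that card_Diff_subset[of x ?X] finite_subset[of x ?X] card_mono[of ?X x] by auto
  have "upper n (n - r - 1) = (\<lambda>x. ?X - x) ` (\<Union>j\<le>r. layer ?X j)"
  proof (intro set_eqI iffI)
    fix x assume "x \<in> upper n (n - r - 1)"
    then have x: "x \<subseteq> ?X" "n - r - 1 < card x" by (auto simp: upper_def cube_def)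
    then have "card (?X - x) \<le> r" using cc[OF x(1)] assms by linarith
    then have "?X - x \<in> (\<Union>j\<le>r. layer ?X j)" by (auto simp: layer_def)
    moreover have "x = ?X - (?X - x)" using x(1) by blast
    ultimately show "x \<in> (\<lambda>x. ?X - x) ` (\<Union>j\<le>r. layer ?X j)" by blast
  next
    fix x assume "x \<in> (\<lambda>x. ?X - x) ` (\<Union>j\<le>r. layer ?X j)"
    then obtain y where y: "y \<subseteq> ?X" "card y \<le> r" "x = ?X - y" by (auto simp: layer_def)
    then have "card x = n - card y" using cc(1)[OF y(1)] by simp
    then have "n - r - 1 < card x" using y(2) assms by linarith
    then show "x \<in> upper n (n - r - 1)" using y by (auto simp: upper_def cube_def)
  qed
  moreover have "inj_on (\<lambda>x. ?X - x) (\<Union>j\<le>r. layer ?X j)"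
    by (rule inj_onI) (auto simp: layer_def)
  ultimately have "card (upper n (n - r - 1)) = card (\<Union>j\<le>r. layer ?X j)"
    by (simp add: card_image)
  also have "\<dots> = (\<Sum>j\<le>r. card (layer ?X j))"
    using finite_layer[of ?X] by (intro card_UN_disjoint) (auto simp: layer_def)
  finally show ?thesis using card_layer[of ?X] by (simp add: f_r_def)
qed

lemma zero_notin_layer: "z \<in> layer {1..n} s \<Longrightarrow> 0 \<notin> z"
  by (auto simp: layer_def)

text \<open>The index \<open>0\<close> gives an initial segment of the cube, minimal by Harper's
  theorem. Up to radius \<open>s\<close> the neighbourhood sizes do not depend on the index, and
  beyond that the initial segment already reaches the whole cube.\<close>

lemma A_i_minimal:
  assumes G: "colex_initial n s G" and "G \<noteq> {}" "s < n"
  shows "nbhd_minimal n t (A_i n s G i)"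
proof -
  let ?U = "A_i n s G 0"
  have GL: "G \<subseteq> layer {1..n} s" using initial_subset[OF G] .
  have mU: "x \<in> ?U \<longleftrightarrow> x \<in> cube n \<and> (s < card x \<or> x \<in> G)" for x
  proof -
    have "0 \<notin> x" if "x \<in> G" using that GL zero_notin_layer by blast
    moreover have "insert 0 x \<notin> G" using GL zero_notin_layer by blast
    ultimately show ?thesis using mem_A_i[OF GL, of x 0] by blast
  qed
  have U: "initial (skey n) (cube n) ?U"
    unfolding initial_def
  proof (intro conjI ballI impI)
    show "?U \<subseteq> cube n" by (rule A_i_subset)
    fix y x assume y: "y \<in> ?U" and x: "x \<in> cube n" and less: "skey n x < skey n y"
    have "y \<in> cube n" using y A_i_subset by blast
    then have l: "card y < card x \<or> card x = card y \<and> set_encode x < set_encode y"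
      using less skey_less_iff[of x n y] x by (simp add: cube_def)
    consider "s < card y" | "y \<in> G" "card y = s" using y mU GL by (auto simp: layer_def)
    then show "x \<in> ?U"
    proof cases
      case 1
      then have "s < card x" using l by linarith
      then show ?thesis using x mU by blast
    next
      case 2
      show ?thesis
      proof (cases "s < card x")
        case False
        then have "card x = s" "set_encode x < set_encode y" using l 2 by auto
        then have "x \<in> G" using initialD[OF G 2(1), of x] x by (auto simp: layer_def cube_def)
        then show ?thesis using x mU by blast
      qed (use x mU in blast)
    qed
  qed
  have min: "nbhd_minimal n t ?U" using initial_nbhd_minimal[OF U] .
  have "card (nbhd n t (A_i n s G i)) \<le> card (nbhd n t ?U)"
  proof (cases "t \<le> s")
    case True
    then show ?thesis using card_nbhd_A_i[OF GL assms(3)] by simp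
  next
    case False
    \<comment> \<open>Since \<open>G\<close> is nonempty its shadow on level \<open>0\<close> is
      full, so radius \<open>s\<close> already covers the cube.\<close>
    have D: "down 0 G = {{}}"
    proof -
      have "finite z" if "z \<in> G" for z using that GL layerD[of "{1..n}" z s] by auto
      then have "x = {}" if "x \<in> down 0 G" for x
        using that unfolding down_def by (auto dest: finite_subset)
      moreover have "{} \<in> down 0 G" using assms(2) by (auto simp: down_def)
      ultimately show ?thesis by blast
    qed
    have "cube n \<subseteq> nbhd n s ?U"
    proof
      fix x assume x: "x \<in> cube n"
      have "nbhd n s ?U = A_i n 0 {{}} 0" using nbhd_A_i[OF GL assms(3), of s] D by simp
      moreover have "x \<in> A_i n 0 {{}} 0"
        using x cube_finite(2)[OF x] mem_A_i[of "{{}}" n 0 x 0] by (auto simp: layer_def)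
      ultimately show "x \<in> nbhd n s ?U" by simp
    qed
    also have "\<dots> \<subseteq> nbhd n t ?U" using False by (intro nbhd_mono) auto
    finally show ?thesis
      using nbhd_subset[of n t "A_i n s G i"] finite_nbhd by (intro card_mono) auto
  qed
  then show ?thesis
    using min card_A_i[OF GL, of i] card_A_i[OF GL, of 0] unfolding nbhd_minimal_def
    by (metis le_trans)
qed

text \<open>The complement is isomorphic to a set of the same form built from the dual segment; the
  strict bound on \<open>card G\<close> makes that segment nonempty.\<close>

lemma A_i_extremal:
  assumes G: "colex_initial n s G" and "G \<noteq> {}" "card G < n choose s" "1 \<le> s" "s < n"
  shows "extremal n (A_i n s G i)"
proof -
  have GL: "G \<subseteq> layer {1..n} s" using initial_subset[OF G] .
  have "card (dual {1..n} s G) > 0" using card_dual[OF _ GL] assms(3) by simp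
  then have ne: "dual {1..n} s G \<noteq> {}" by auto
  have "nbhd_minimal n t (A_i n (n - s) (dual {1..n} s G) i)" for t
    using assms(4,5) by (intro A_i_minimal colex_initial_dual[OF G] ne) auto
  then have "nbhd_minimal n t (cube n - A_i n s G i)" for t
    using cube_iso_minimal[OF compl_A_i_iso[OF GL] Diff_subset] assms(5) by simp
  then show ?thesis using A_i_minimal[OF G assms(2,5)] by (simp add: extremal_def)
qed

lemma cmap_comp:
  assumes "bij_betw \<sigma> {1..n} {1..n}" "bij_betw \<tau> {1..n} {1..n}" "I \<subseteq> {1..n}" "x \<subseteq> {1..n}"
  shows "cmap \<tau> J (cmap \<sigma> I x) = cmap (\<tau> \<circ> \<sigma>) (cmap \<tau> J I) x"
proof -
  have sub: "\<sigma> ` x \<subseteq> {1..n}" using assms(1,4) by (auto simp: bij_betw_def)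
  have inj: "inj_on \<tau> {1..n}" using assms(2) by (simp add: bij_betw_def)
  have d: "\<tau> ` (u - v) = \<tau> ` u - \<tau> ` v" if "u \<subseteq> {1..n}" "v \<subseteq> {1..n}" for u v
    using that inj_on_image_set_diff[OF inj, of u v] by auto
  show ?thesis
    unfolding cmap_def image_Un image_comp[symmetric] d[OF sub assms(3)] d[OF assms(3) sub] by blast
qed

lemma cube_iso_trans:
  assumes AB: "cube_iso n A B" and BC: "cube_iso n B C" and A: "A \<subseteq> cube n"
  shows "cube_iso n A C"
proof -
  obtain \<sigma> I where \<sigma>: "bij_betw \<sigma> {1..n} {1..n}" "I \<subseteq> {1..n}" "cmap \<sigma> I ` A = B"
    using AB by (auto simp: cube_iso_iff)
  obtain \<tau> J where \<tau>: "bij_betw \<tau> {1..n} {1..n}" "J \<subseteq> {1..n}" "cmap \<tau> J ` B = C"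
    using BC by (auto simp: cube_iso_iff)
  have "cmap (\<tau> \<circ> \<sigma>) (cmap \<tau> J I) ` A = C"
  proof -
    have "cmap (\<tau> \<circ> \<sigma>) (cmap \<tau> J I) ` A = (\<lambda>x. cmap \<tau> J (cmap \<sigma> I x)) ` A"
      using cmap_comp[OF \<sigma>(1) \<tau>(1) \<sigma>(2), of _ J] A by (intro image_cong) (auto simp: cube_def)
    then show ?thesis using \<sigma>(3) \<tau>(3) by (metis image_image)
  qed
  moreover have "cmap \<tau> J I \<subseteq> {1..n}"
    using bij_betwE[OF cmap_bij[OF \<tau>(1,2)]] \<sigma>(2) unfolding cube_def by blast
  ultimately show ?thesis
    unfolding cube_iso_iff using bij_betw_trans[OF \<sigma>(1) \<tau>(1)] by blast
qed

text \<open>The condition on \<open>i\<close> and \<open>i'\<close> is asked only on members of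
  \<open>F\<close>, so that it covers \<open>i' = \<sigma> i\<close> as well as \<open>i = 0\<close>
  with \<open>i'\<close> a point that no image contains.\<close>

lemma perm_A_i:
  assumes \<sigma>: "bij_betw \<sigma> {1..n} {1..n}" and F: "F \<subseteq> layer {1..n} s"
    and i: "\<And>z. z \<in> F \<Longrightarrow> \<sigma> ` (z - {i}) = \<sigma> ` z - {i'}"
  shows "cube_iso n (A_i n s F i) (A_i n s ((`) \<sigma> ` F) i')"
proof -
  have inj: "inj_on \<sigma> {1..n}" and surj: "\<sigma> ` {1..n} = {1..n}" using \<sigma> by (auto simp: bij_betw_def)
  have cd: "card (\<sigma> ` z) = card z" if "z \<subseteq> {1..n}" for z
    using that inj by (meson card_image inj_on_subset)
  have sub: "\<sigma> ` z \<subseteq> {1..n}" if "z \<subseteq> {1..n}" for z using that surj by blast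
  have FL: "(`) \<sigma> ` F \<subseteq> layer {1..n} s"
  proof
    fix w assume "w \<in> (`) \<sigma> ` F"
    then obtain z where "z \<in> F" "w = \<sigma> ` z" by blast
    then show "w \<in> layer {1..n} s" using F cd[of z] sub[of z] unfolding layer_def by auto
  qed
  have up: "(`) \<sigma> ` upper n s = upper n s"
  proof (intro set_eqI iffI)
    fix w assume "w \<in> (`) \<sigma> ` upper n s"
    then obtain z where "z \<subseteq> {1..n}" "s < card z" "w = \<sigma> ` z" by (auto simp: upper_def cube_def)
    then show "w \<in> upper n s" using cd[of z] sub[of z] by (simp add: upper_def cube_def)
  next
    fix w assume w: "w \<in> upper n s"
    then have "w \<subseteq> \<sigma> ` {1..n}" using surj by (simp add: upper_def cube_def)
    then obtain z where z: "z \<subseteq> {1..n}" "w = \<sigma> ` z" by (meson subset_imageE)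
    then have "z \<in> upper n s" using w cd[of z] by (simp add: upper_def cube_def)
    then show "w \<in> (`) \<sigma> ` upper n s" using z by blast
  qed
  have "(`) \<sigma> ` ((\<lambda>z. z - {i}) ` F) = (\<lambda>z. z - {i'}) ` ((`) \<sigma> ` F)"
    unfolding image_image using i by (rule image_cong[OF refl])
  then have "(`) \<sigma> ` A_i n s F i = A_i n s ((`) \<sigma> ` F) i'"
    unfolding A_i_eq[OF F] A_i_eq[OF FL] image_Un up by simp
  moreover have "cmap \<sigma> {} = (`) \<sigma>" by (auto simp: cmap_def fun_eq_iff)
  ultimately show ?thesis unfolding cube_iso_iff using \<sigma> by (metis empty_subsetI)
qed

text \<open>The value \<open>i = 0\<close> lies outside the ground set and stands for the Hamming ball case, in which
  no coordinate is flipped.\<close>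

lemma A_i_structure:
  assumes A: "upper n s \<subseteq> A" "A \<subseteq> cube n" and p: "p \<in> cube n" "\<And>x. x \<in> A \<Longrightarrow> s \<le> hdist p x"
    and s: "1 \<le> s" "s < n"
  shows "\<exists>i F. (i = 0 \<or> i \<in> {1..n}) \<and> F \<subseteq> layer {1..n} s \<and> A = A_i n s F i"
proof -
  let ?X = "{1..n}"
  have fp: "finite p" "p \<subseteq> ?X" using p(1) cube_finite(2) by (auto simp: cube_def)
  \<comment> \<open>If \<open>p\<close> has more than \<open>s\<close> elements it lies in
    \<open>A\<close>; otherwise a superset of size \<open>Suc s\<close> lies in \<open>A\<close>, at
    distance \<open>Suc s - card p\<close>, which must be at least \<open>s\<close>.\<close>
  have "card p \<le> 1"
  proof (rule ccontr)
    assume p2: "\<not> card p \<le> 1"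
    show False
    proof (cases "s < card p")
      case True
      then have "p \<in> A" using A(1) p(1) by (auto simp: upper_def)
      then show False using p(2)[of p] s by (simp add: hdist_def)
    next
      case False
      then obtain y where y: "p \<subseteq> y" "y \<subseteq> ?X" "card y = Suc s"
        using exists_subset_between[of p "Suc s" ?X] fp s by auto
      then have "y \<in> A" using A(1) by (auto simp: upper_def cube_def)
      then have "s \<le> hdist p y" using p(2) by blast
      moreover have "(p - y) \<union> (y - p) = y - p" using y by blast
      ultimately have "s \<le> card y - card p" using card_Diff_subset[OF fp(1) y(1)] by (simp add: hdist_def)
      then show False using y(3) p2 s by linarith
    qed
  qed
  then consider "p = {}" | j where "p = {j}"
    using fp(1) by (metis One_nat_def card_0_eq card_1_singletonE le_Suc_eq le_zero_eq)
  then obtain i where i: "p = {} \<and> i = 0 \<or> p = {i} \<and> i \<in> ?X" using fp(2) by cases auto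
  have fA: "finite x" "x \<subseteq> ?X" if "x \<in> A" for x using that A(2) cube_finite(2) by (auto simp: cube_def)
  \<comment> \<open>For \<open>p = {i}\<close> the distance to \<open>x\<close> is
    \<open>card x\<close> minus one if \<open>i\<close> is in \<open>x\<close>, and plus one
    otherwise. Hence sets containing \<open>i\<close> exceed size \<open>s\<close>, and sets
    avoiding it may go down to size \<open>s - 1\<close>.\<close>
  have in1: "s < card x" if x: "x \<in> A" "i \<in> x" for x
  proof -
    have "p = {i}" using i x fA(2)[OF x(1)] by auto
    then have "(p - x) \<union> (x - p) = x - {i}" using x by auto
    then have "s \<le> card (x - {i})" using p(2)[OF x(1)] by (simp add: hdist_def)
    then show ?thesis using card_Suc_Diff1[OF fA(1)[OF x(1)] x(2)] by linarith
  qed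
  have out: "s \<le> card x \<or> s = Suc (card x) \<and> i \<in> ?X" if x: "x \<in> A" "i \<notin> x" for x
  proof (cases "p = {}")
    case True
    then show ?thesis using p(2)[OF x(1)] by (simp add: hdist_def)
  next
    case False
    then have "p = {i}" "i \<in> ?X" using i by auto
    then have "(p - x) \<union> (x - p) = insert i x" using x by auto
    then have "s \<le> Suc (card x)" using p(2)[OF x(1)] x(2) fA(1)[OF x(1)] by (simp add: hdist_def)
    then show ?thesis using \<open>i \<in> ?X\<close> by linarith
  qed
  define F where "F = {z \<in> layer ?X s. z - {i} \<in> A}"
  have FL: "F \<subseteq> layer ?X s" by (auto simp: F_def)
  have "x \<in> A \<longleftrightarrow> x \<in> A_i n s F i" for x
  proof
    assume x: "x \<in> A"
    show "x \<in> A_i n s F i"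
    proof (cases "s < card x")
      case True
      then show ?thesis using mem_A_i[OF FL] x A(2) by blast
    next
      case False
      then have ix: "i \<notin> x" using in1 x by blast
      have xi: "x - {i} = x" "insert i x - {i} = x" using ix by auto
      consider "card x = s" | "s = Suc (card x)" "i \<in> ?X" using out[OF x ix] False by linarith
      then have "x \<in> F \<or> insert i x \<in> F"
      proof cases
        case 1
        then show ?thesis unfolding F_def layer_def using fA[OF x] x xi by auto
      next
        case 2
        then have "insert i x \<in> layer ?X s" using fA[OF x] ix by (simp add: layer_def)
        then show ?thesis unfolding F_def using x xi by auto
      qed
      then show ?thesis using mem_A_i[OF FL] x ix A(2) by blast
    qed
  next
    assume "x \<in> A_i n s F i"
    then consider "x \<in> upper n s" | "i \<notin> x" "x \<in> F" | "i \<notin> x" "insert i x \<in> F"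
      unfolding mem_A_i[OF FL] upper_def by blast
    then show "x \<in> A"
    proof cases
      case 1
      then show ?thesis using A(1) by blast
    next
      case 2
      then show ?thesis by (simp add: F_def)
    next
      case 3
      then have "insert i x - {i} = x" by auto
      then show ?thesis using 3 by (simp add: F_def)
    qed
  qed
  then show ?thesis using FL i by blast
qed

lemma nbhd_compl_ball:
  assumes "q \<in> cube n - nbhd n r (cube n - A)" "x \<in> cube n" "hdist q x \<le> r"
  shows "x \<in> A"
  using assms unfolding nbhd_def by blast

lemma extremal_imp_iso:
  assumes A: "A \<subseteq> cube n" "extremal n A" and G: "colex_initial n s G" "G \<subseteq> layer {1..n - 1} s"
    and cA: "card A = card (upper n s) + card G" and s: "1 \<le> s" "s < n"
  shows "\<exists>i\<in>{1..n}. cube_iso n A (A_i n s G i)"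
proof -
  let ?X = "{1..n}" let ?V = "A_i n s G 0"
  have GL: "G \<subseteq> layer ?X s" using initial_subset[OF G(1)] .
  have Vc: "?V \<subseteq> cube n" by (rule A_i_subset)
  have cV: "card ?V = card A" using card_A_i[OF GL] cA by simp
  have cVc: "card (cube n - ?V) = card (cube n - A)"
    using cV card_Diff_subset[of A "cube n"] card_Diff_subset[of ?V "cube n"] A(1) Vc
      finite_subset[OF _ cube_finite(1)] by metis
  \<comment> \<open>Extremality speaks of positive radii only. Radius \<open>0\<close> is settled by
    the equal sizes; it occurs below for \<open>s = 1\<close>, and in the companion bound for
    \<open>s = n - 1\<close>.\<close>
  have le1: "card (nbhd n t A) \<le> card (nbhd n t ?V)" for t
    using A(2) Vc cV nbhd_0[OF A(1)] nbhd_0[OF Vc]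
    by (cases "t = 0") (auto simp: extremal_def nbhd_minimal_def)
  have le2: "card (nbhd n t (cube n - A)) \<le> card (nbhd n t (cube n - ?V))" for t
    using A(2) cVc nbhd_0[of "cube n - A" n] nbhd_0[of "cube n - ?V" n]
    by (cases "t = 0") (auto simp: extremal_def nbhd_minimal_def)
  have Vge: "s \<le> card x" if x: "x \<in> ?V" for x
  proof -
    have "insert 0 x \<notin> G" using GL zero_notin_layer by blast
    then have "s < card x \<or> x \<in> G" using x mem_A_i[OF GL, of x 0] by blast
    then show ?thesis using GL by (auto simp: layer_def)
  qed
  have Vup: "card x \<le> s" if "x \<in> cube n - ?V" for x
    using that mem_A_i[OF GL, of x 0] by auto
  have ex: "\<exists>q. q \<in> cube n - nbhd n t B" if "card (nbhd n t B) \<le> card (nbhd n t C)"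
    "z \<in> cube n" "z \<notin> nbhd n t C" for t B C z
  proof (rule ccontr)
    assume "\<not> ?thesis"
    then have "nbhd n t B = cube n" using nbhd_subset[of n t B] by blast
    moreover have "card (nbhd n t C) < card (cube n)"
      using that(2,3) nbhd_subset[of n t C] by (intro psubset_card_mono cube_finite(1)) auto
    ultimately show False using that(1) by simp
  qed
  \<comment> \<open>Sets outside \<open>?V\<close> have at most \<open>s\<close> elements. As the
    complement of \<open>A\<close> does no better, some ball of radius \<open>n - s - 1\<close> lies
    in \<open>A\<close>; its centre is \<open>q\<close>.\<close>
  have "?X \<notin> nbhd n (n - s - 1) (cube n - ?V)"
  proof
    assume "?X \<in> nbhd n (n - s - 1) (cube n - ?V)"
    then obtain x where x: "x \<in> cube n - ?V" "hdist ?X x \<le> n - s - 1" by (auto simp: nbhd_def)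
    then have xX: "x \<subseteq> ?X" "finite x" using cube_finite(2) by (auto simp: cube_def)
    then have "(?X - x) \<union> (x - ?X) = ?X - x" by blast
    then have "hdist ?X x = n - card x" using card_Diff_subset[OF xX(2,1)] by (simp add: hdist_def)
    then show False using x(2) Vup[OF x(1)] s by linarith
  qed
  then obtain q where q: "q \<in> cube n - nbhd n (n - s - 1) (cube n - A)"
    using ex[OF le2, of ?X] by (auto simp: cube_def)
  \<comment> \<open>Members of \<open>?V\<close> have at least \<open>s\<close> elements, so
    \<open>A\<close> also misses some point \<open>p\<close> at radius \<open>s - 1\<close>.\<close>
  have "{} \<notin> nbhd n (s - 1) ?V"
  proof
    assume "{} \<in> nbhd n (s - 1) ?V"
    then obtain x where "x \<in> ?V" "hdist {} x \<le> s - 1" by (auto simp: nbhd_def)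
    then show False using Vge[of x] s by (simp add: hdist_def)
  qed
  then obtain p where p: "p \<in> cube n" "p \<notin> nbhd n (s - 1) A"
    using ex[OF le1, of "{}"] by (auto simp: cube_def)
  have pA: "s \<le> hdist p x" if "x \<in> A" for x
    using that p s unfolding nbhd_def by (cases "hdist p x \<le> s - 1") auto
  \<comment> \<open>The translation taking \<open>q\<close> to the full set; the ball around
    \<open>q\<close> becomes \<open>upper n s\<close>.\<close>
  let ?f = "cmap id (?X - q)"
  have bij: "bij_betw ?f (cube n) (cube n)" by (rule cmap_bij) auto
  have idb: "bij_betw id ?X ?X" by simp
  have qX: "q \<subseteq> ?X" "q \<in> cube n" using q by (auto simp: cube_def)
  have fq: "?f q = ?X" unfolding cmap_def using qX by auto
  define A' where "A' = ?f ` A"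
  have iso: "cube_iso n A A'" unfolding cube_iso_iff A'_def by (intro exI[of _ id] exI[of _ "?X - q"]) auto
  have A'c: "A' \<subseteq> cube n" using cube_iso_card_nbhd(3)[OF iso A(1)] .
  have "upper n s \<subseteq> A'"
  proof
    fix y assume y: "y \<in> upper n s"
    then have yX: "y \<subseteq> ?X" "finite y" "y \<in> cube n" "s < card y"
      using cube_finite(2)[of y n] by (auto simp: upper_def cube_def)
    then obtain x where x: "x \<in> cube n" "y = ?f x" using bij_betw_imp_surj_on[OF bij] by blast
    have "(?X - y) \<union> (y - ?X) = ?X - y" using yX(1) by blast
    then have "hdist ?X y = n - card y" using card_Diff_subset[OF yX(2,1)] by (simp add: hdist_def)
    then have "hdist q x \<le> n - s - 1" using hdist_cmap[OF idb qX(2) x(1), of "?X - q"] fq x(2) yX(4) by simp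
    then have "x \<in> A" using nbhd_compl_ball[OF q x(1)] by blast
    then show "y \<in> A'" using x(2) by (simp add: A'_def)
  qed
  moreover have "?f p \<in> cube n" using bij_betwE[OF bij] p(1) by blast
  moreover have "s \<le> hdist (?f p) y" if "y \<in> A'" for y
    using that pA hdist_cmap[OF idb p(1), of _ "?X - q"] A(1) by (auto simp: A'_def)
  ultimately obtain i F where i: "i = 0 \<or> i \<in> ?X" and F: "F \<subseteq> layer ?X s" and A': "A' = A_i n s F i"
    using A_i_structure[OF _ A'c, of s "?f p"] s by blast
  have cFG: "card F = card G"
    using card_A_i[OF F, of i] A' cA cube_iso_card_nbhd(2)[OF iso A(1)] by simp
  \<comment> \<open>Radius \<open>s - l\<close> isolates level \<open>l\<close>: the contribution of
    \<open>upper n l\<close> is the same on both sides.\<close>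
  have dn: "card (down l F) \<le> card (down l G)" for l
  proof (cases "l \<le> s")
    case True
    have "card (nbhd n (s - l) (A_i n s F i)) \<le> card (nbhd n (s - l) ?V)"
      using le1 cube_iso_card_nbhd(1)[OF iso A(1)] A' by simp
    then show ?thesis
      using card_nbhd_A_i[OF F s(2), of "s - l"] card_nbhd_A_i[OF GL s(2), of "s - l"] True by simp
  next
    case False
    then show ?thesis using down_empty_above[OF _ F, of l] by simp
  qed
  have dF: "dual ?X s F \<subseteq> layer ?X (n - s)" and dG: "dual ?X s G \<subseteq> layer ?X (n - s)"
    using dual_layer[of ?X s] by auto
  \<comment> \<open>The second half of extremality gives the dual inequalities, because both
    complements are isomorphic to sets built from the dual families.\<close>
  have dd: "card (down l (dual ?X s F)) \<le> card (down l (dual ?X s G))" for l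
  proof (cases "l \<le> n - s")
    case True
    let ?t = "n - s - l"
    have "card (nbhd n ?t (A_i n (n - s) (dual ?X s F) i)) = card (nbhd n ?t (cube n - A_i n s F i))"
      using cube_iso_card_nbhd(1)[OF compl_A_i_iso[OF F] Diff_subset] s by simp
    also have "\<dots> = card (nbhd n ?t (cube n - A))"
      using cube_iso_card_nbhd(1)[OF cube_iso_card_nbhd(4)[OF iso A(1)] Diff_subset] A' by simp
    also have "\<dots> \<le> card (nbhd n ?t (cube n - ?V))" by (rule le2)
    also have "\<dots> = card (nbhd n ?t (A_i n (n - s) (dual ?X s G) 0))"
      using cube_iso_card_nbhd(1)[OF compl_A_i_iso[OF GL] Diff_subset] s by simp
    finally show ?thesis
      using card_nbhd_A_i[OF dF, of ?t] card_nbhd_A_i[OF dG, of ?t] True s by simp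
  next
    case False
    then show ?thesis using down_empty_above[OF _ dF, of l] by simp
  qed
  obtain \<sigma> where \<sigma>: "bij_betw \<sigma> ?X ?X" "(`) \<sigma> ` F = G"
    using family_unique[OF _ _ _ F G(1) cFG dn dd] s by auto
  \<comment> \<open>No member of \<open>G\<close> contains \<open>n\<close>, so for
    \<open>i = 0\<close>, where nothing is deleted, \<open>n\<close> can serve as the index.\<close>
  define i' where "i' = (if i = 0 then n else \<sigma> i)"
  have i': "i' \<in> ?X" using i \<sigma>(1) s by (auto simp: i'_def bij_betw_def)
  have "\<sigma> ` (z - {i}) = \<sigma> ` z - {i'}" if z: "z \<in> F" for z
  proof (cases "i = 0")
    case True
    have "0 \<notin> z" using z F zero_notin_layer by blast
    moreover have "n \<notin> \<sigma> ` z"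
    proof -
      have "\<sigma> ` z \<in> layer {1..n - 1} s" using z \<sigma>(2) G(2) by blast
      then show ?thesis using s unfolding layer_def by fastforce
    qed
    ultimately show ?thesis using True by (simp add: i'_def)
  next
    case False
    then have "i \<in> ?X" using i by simp
    moreover have "z \<subseteq> ?X" using z F by (auto simp: layer_def)
    ultimately show ?thesis
      using inj_on_image_set_diff[OF bij_betw_imp_inj_on[OF \<sigma>(1)], of z "{i}"] False
      by (auto simp: i'_def)
  qed
  then have "cube_iso n A' (A_i n s G i')" using perm_A_i[OF \<sigma>(1) F] \<sigma>(2) A' by blast
  then show ?thesis using cube_iso_trans[OF iso _ A(1)] i' by blast
qed

theorem theorem2:
  fixes n r :: nat and A :: "nat set set"
  assumes "n \<ge> 1" and "r \<le> n - 1"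
    and "A \<subseteq> cube n"
    and "f_r n r < card A" and "card A \<le> g_r n r"
  shows "extremal n A \<longleftrightarrow>
    (\<exists>i\<in>{1..n}. cube_iso n A
       (A_i n (n - r - 1) (colex_seg n (n - r - 1) (card A - f_r n r)) i))"
proof -
  define s where "s = n - r - 1"
  define k where "k = card A - f_r n r"
  define G where "G = colex_seg n s k"
  obtain m where m: "n = Suc m" using assms(1) by (cases n) auto
  have cu: "card (upper n s) = f_r n r" using card_upper[OF assms(1,2)] by (simp add: s_def)
  have "k \<le> m choose r" using assms(5) m by (simp add: k_def g_r_def)
  also have "m choose r = m choose s" using binomial_symmetric[of r m] assms(2) m by (simp add: s_def)
  finally have km: "k \<le> m choose s" .
  have kn: "k \<le> n choose s" using km m by (cases s) (simp_all add: trans_le_add2)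
  have G: "colex_initial n s G" "card G = k" using colex_seg_initial[OF kn] by (auto simp: G_def)
  have GL: "G \<subseteq> layer {1..n} s" using initial_subset[OF G(1)] .
  have k1: "k \<ge> 1" and cA: "card A = card (upper n s) + card G"
    using assms(4) cu G(2) by (auto simp: k_def)
  have "extremal n A \<longleftrightarrow> (\<exists>i\<in>{1..n}. cube_iso n A (A_i n s G i))"
  proof (cases "s = 0")
    \<comment> \<open>Here \<open>r = n - 1\<close>, and the lower size bound leaves only the whole
      cube.\<close>
    case True
    have "cube n = insert {} (upper n 0)"
      using cube_finite(2) by (auto simp: upper_def cube_def card_gt_0_iff)
    moreover have "finite (upper n 0)" "{} \<notin> upper n 0" using cube_finite(1) by (auto simp: upper_def)
    ultimately have "card (cube n) \<le> card A" using cA G(2) k1 True by simp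
    then have Ac: "A = cube n" using card_seteq[OF cube_finite(1) assms(3)] by blast
    have "card (A_i n s G 1) = card (cube n)" using card_A_i[OF GL, of 1] cA Ac by simp
    then have "A_i n s G 1 = cube n" using card_subset_eq[OF cube_finite(1) A_i_subset] by blast
    moreover have "cube_iso n (cube n) (cube n)"
    proof -
      have "cmap id {} ` cube n = cube n" by (auto simp: cmap_def)
      then show ?thesis unfolding cube_iso_iff by (metis bij_betw_id empty_subsetI)
    qed
    ultimately have "\<exists>i\<in>{1..n}. cube_iso n A (A_i n s G i)" using Ac assms(1)
      by (intro bexI[of _ 1]) simp_all
    moreover have "extremal n A"
      unfolding extremal_def nbhd_minimal_def Ac
      using card_subset_eq[OF cube_finite(1)] by (auto simp: nbhd_def)
    ultimately show ?thesis by blast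
  next
    case False
    then have s: "1 \<le> s" "s < n" using assms(1) by (auto simp: s_def)
    have "G \<subseteq> layer {1..n - 1} s" using colex_seg_restrict[OF km] m by (simp add: G_def)
    then have "\<exists>i\<in>{1..n}. cube_iso n A (A_i n s G i)" if "extremal n A"
      using extremal_imp_iso[OF assms(3) that G(1) _ cA s] by blast
    moreover have "extremal n A" if iso: "cube_iso n A (A_i n s G i)" for i
    proof (rule cube_iso_extremal[OF iso assms(3)])
      obtain s' where s': "s = Suc s'" using s by (cases s) auto
      \<comment> \<open>By Pascal's rule \<open>n choose s\<close> exceeds \<open>m choose s\<close>
        by this positive amount, so \<open>G\<close> is not the whole layer.\<close>
      have "m choose s' > 0" using s s' m by simp
      moreover have "n choose s = (m choose s') + (m choose s)" using m s' by simp
      ultimately have "card G < n choose s" using km G(2) by linarith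
      moreover have "G \<noteq> {}" using G(2) k1 by auto
      ultimately show "extremal n (A_i n s G i)" using A_i_extremal[OF G(1)] s by blast
    qed
    ultimately show ?thesis by blast
  qed
  then show ?thesis by (simp add: s_def k_def G_def)
qed

end
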